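(* Let $m$ be odd, let $n$ be a divisor of $m$ with $n\neq m$, and let $i$ be a positive integer with $\gcd(m,i)=1$. Writing $T(x)=tr_{m/n}(x)$ and $W(x)=T(x)^{2^i+1}+tr_{m/n}(x^{2^i+1})+T(x)$, define $F':\mathbb{F}_{2^m}\to\mathbb{F}_{2^m}$ by $$F'(x)=x^{2^i+1}+tr_{m/n}(x^{2^i+1})+x^{2^i}T(x)+x\,T(x)^{2^i}+W(x)^{\frac{1}{2^i+1}}\big(x^{2^i}+T(x)^{2^i}+1\big)+W(x)^{\frac{2^i}{2^i+1}}\big(x+T(x)\big).$$ Then $F'$ is almost bent (AB), and $F'$ is EA-inequivalent to every power function on $\mathbb{F}_{2^m}$.
   Context: For $n\mid m$, $tr_{m/n}(x)=x+x^{2^n}+x^{2^{2n}}+\dots+x^{2^{(m/n-1)n}}$ is the relative trace from $\mathbb{F}_{2^m}$ to $\mathbb{F}_{2^n}$, and $tr(x)=x+x^2+\dots+x^{2^{m-1}}$ is the absolute trace. Since $m$ is odd, $x\mapsto x^{2^i+1}$ is a permutation of $\mathbb{F}_{2^m}$; $y^{\frac{1}{2^i+1}}$ denotes the unique $z$ with $z^{2^i+1}=y$, and $y^{\frac{2^i}{2^i+1}}=(y^{\frac{1}{2^i+1}})^{2^i}$. For $F:\mathbb{F}_{2^m}\to\mathbb{F}_{2^m}$ and $a,b\in\mathbb{F}_{2^m}$ let $\lambda_F(a,b)=\sum_{x}(-1)^{tr(bF(x)+ax)}$; the nonlinearity is $\mathcal{NL}(F)=2^{m-1}-\frac12\max_{a,\,b\neq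 0}|\lambda_F(a,b)|$, and $F$ is almost bent (AB) if $\mathcal{NL}(F)=2^{m-1}-2^{(m-1)/2}$. A function is affine if it is a linearized polynomial $\sum_j c_jx^{2^j}$ plus a constant. Functions $F,F'$ are EA-equivalent if $F'=A_1\circ F\circ A_2+A$ for some affine permutations $A_1,A_2$ and some affine function $A$. A power function is a map $x\mapsto x^d$ for some integer $d$.
   Formalization: EA-inequivalence to power functions is claimed only for m ≠ 3, because for m = 3 (so n = 1) it fails: for i = 1, F'(x) = x^3 + x^2 + x is EA-equivalent to x^3; the AB claim is kept for all m. *)

theory Defs
  imports Complex_Main "HOL-Library.Cardinality"
begin

text \<open>
  The field with \<open>2 ^ m\<close> elements is a type \<open>'a :: {field, finite}\<close> with \<open>CARD('a) = 2 ^ m\<close>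
  (which forces characteristic 2). The exponent \<open>m\<close> is an explicit argument of the
  definitions below; they are meant for such a type only.
\<close>

definition rel_trace :: "nat \<Rightarrow> nat \<Rightarrow> 'a::{field,finite} \<Rightarrow> 'a"
  where "rel_trace m n x = (\<Sum>k<m div n. x ^ (2 ^ (k * n)))"

definition abs_trace :: "nat \<Rightarrow> 'a::{field,finite} \<Rightarrow> 'a"
  where "abs_trace m x = (\<Sum>k<m. x ^ (2 ^ k))"

text \<open>The absolute trace takes the values \<open>0\<close> and \<open>1\<close> of \<open>'a\<close>, here used as an exponent of \<open>- 1\<close>.\<close>

definition trace_sign :: "nat \<Rightarrow> 'a::{field,finite} \<Rightarrow> int"
  where "trace_sign m x = (if abs_trace m x = 0 then 1 else - 1)"

definition walsh :: "nat \<Rightarrow> ('a \<Rightarrow> 'a) \<Rightarrow> 'a::{field,finite} \<Rightarrow> 'a \<Rightarrow> int"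
  where "walsh m F a b = (\<Sum>x\<in>UNIV. trace_sign m (b * F x + a * x))"

definition nonlinearity :: "nat \<Rightarrow> ('a::{field,finite} \<Rightarrow> 'a) \<Rightarrow> real"
  where "nonlinearity m F =
    2 ^ (m - 1) - 1 / 2 * real_of_int (Max {\<bar>walsh m F a b\<bar> | a b. b \<noteq> 0})"

definition almost_bent :: "nat \<Rightarrow> ('a::{field,finite} \<Rightarrow> 'a) \<Rightarrow> bool"
  where "almost_bent m F \<longleftrightarrow> nonlinearity m F = 2 ^ (m - 1) - 2 powr ((real m - 1) / 2)"

definition affine_fun :: "('a::{field,finite} \<Rightarrow> 'a) \<Rightarrow> bool"
  where "affine_fun A \<longleftrightarrow>
    (\<exists>(N::nat) (c :: nat \<Rightarrow> 'a) (d :: 'a). \<forall>x. A x = (\<Sum>j<N. c j * x ^ (2 ^ j)) + d)"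

definition affine_perm :: "('a::{field,finite} \<Rightarrow> 'a) \<Rightarrow> bool"
  where "affine_perm A \<longleftrightarrow> affine_fun A \<and> bij A"

definition EA_equivalent :: "('a::{field,finite} \<Rightarrow> 'a) \<Rightarrow> ('a \<Rightarrow> 'a) \<Rightarrow> bool"
  where "EA_equivalent F F' \<longleftrightarrow>
    (\<exists>A1 A2 A. affine_perm A1 \<and> affine_perm A2 \<and> affine_fun A \<and>
       F' = (\<lambda>x. A1 (F (A2 x)) + A x))"

text \<open>
  Negative exponents are allowed; \<open>0 powi d = 0\<close> for \<open>d < 0\<close>, so that
  \<open>x powi (- 1)\<close> is \<open>x ^ (2 ^ m - 2)\<close> for \<open>m > 1\<close>.
\<close>

definition power_function :: "('a::{field,finite} \<Rightarrow> 'a) \<Rightarrow> bool"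
  where "power_function P \<longleftrightarrow> (\<exists>d::int. \<forall>x. P x = x powi d)"

text \<open>\<open>y\<close> to the power \<open>1 / (2 ^ i + 1)\<close>; well defined when \<open>m\<close> is odd.\<close>

definition gold_root :: "nat \<Rightarrow> 'a::{field,finite} \<Rightarrow> 'a"
  where "gold_root i y = (THE z. z ^ (2 ^ i + 1) = y)"

definition W_fun :: "nat \<Rightarrow> nat \<Rightarrow> nat \<Rightarrow> 'a::{field,finite} \<Rightarrow> 'a"
  where "W_fun m n i x =
    (let T = rel_trace m n in T x ^ (2 ^ i + 1) + T (x ^ (2 ^ i + 1)) + T x)"

definition F_prime :: "nat \<Rightarrow> nat \<Rightarrow> nat \<Rightarrow> 'a::{field,finite} \<Rightarrow> 'a"
  where "F_prime m n i x =
    (let T = rel_trace m n; R = gold_root i (W_fun m n i x) in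
       x ^ (2 ^ i + 1) + T (x ^ (2 ^ i + 1)) + x ^ (2 ^ i) * T x + x * T x ^ (2 ^ i)
       + R * (x ^ (2 ^ i) + T x ^ (2 ^ i) + 1)
       + R ^ (2 ^ i) * (x + T x))"

text \<open>
  For \<open>m = 3\<close>, \<open>n = 1\<close>, \<open>i = 1\<close> the function reduces to \<open>x ^ 3 + x ^ 2 + x\<close>, which is
  EA-equivalent to the power function \<open>x ^ 3\<close>. EA-inequivalence to power functions therefore
  fails on the field with 8 elements and can only be claimed for \<open>m \<noteq> 3\<close>.
\<close>

lemma finite_field_power_card:
  fixes x :: "'a::{field,finite}"
  shows "x ^ CARD('a) = x"
proof (cases "x = 0")
  case False
  let ?U = "UNIV - {0::'a}"
  have "bij_betw ((*) x) ?U ?U"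
    by (rule bij_betw_byWitness[where f' = "\<lambda>y. y / x"]) (use False in auto)
  hence "(\<Prod>y\<in>?U. x * y) = (\<Prod>y\<in>?U. y)"
    by (rule prod.reindex_bij_betw)
  hence "x ^ card ?U * (\<Prod>y\<in>?U. y) = 1 * (\<Prod>y\<in>?U. y)"
    by (simp add: prod.distrib)
  moreover have "(\<Prod>y\<in>?U. y) \<noteq> 0" by simp
  ultimately have "x ^ card ?U = 1" by (metis mult_right_cancel)
  moreover have "CARD('a) = Suc (card ?U)"
    by (rule card.remove) auto
  ultimately show ?thesis
    by (simp only: power_Suc mult_1_right)
qed simp

lemma F_prime_dim3:
  fixes x :: "'a::{field,finite}"
  assumes "CARD('a) = 2 ^ 3"
  shows "F_prime 3 1 1 x = x ^ 3 + x ^ 2 + x"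
proof -
  have e: "y ^ 8 = y" for y :: 'a
    using finite_field_power_card[of y] assms by simp
  have "(- 1) ^ 8 = (- 1 :: 'a)" by (rule e)
  hence two: "y + y = 0" for y :: 'a
    by (metis add.right_inverse mult.left_neutral mult_minus_left power_minus_even
        even_numeral power_one)
  have two': "2 * y = 0" for y :: 'a
    unfolding mult_2 by (rule two)
  have tr: "rel_trace 3 1 y = y + y ^ 2 + y ^ 4" for y :: 'a
    by (simp add: rel_trace_def numeral_3_eq_3)
  have tr_idem: "(rel_trace 3 1 y) ^ 2 = rel_trace 3 1 y" for y :: 'a
  proof -
    have "(y + y ^ 2 + y ^ 4) ^ 2 =
        y ^ 2 + y ^ 4 + y ^ 8 + 2 * (y ^ 3 + y ^ 5 + y ^ 6)"
      by algebra
    thus ?thesis unfolding tr two' e by (simp add: ac_simps)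
  qed
  define t where "t = rel_trace 3 1 x"
  define s where "s = rel_trace 3 1 (x ^ 3)"
  have t: "t ^ 2 = t" and s: "s ^ 2 = s"
    unfolding t_def s_def by (rule tr_idem)+
  have "t = 0 \<or> t = 1" "s = 0 \<or> s = 1"
    using t s by (simp_all add: power2_eq_square)
  hence t3: "t ^ 3 = t" and s3: "s ^ 3 = s" and s4: "s ^ 4 = s"
    by auto
  have ex: "2 + 1 = (3::nat)" "2 ^ 1 = (2::nat)"
    by simp_all
  have W: "W_fun 3 1 1 x = s"
    using two[of t] t3
    unfolding W_fun_def Let_def ex t_def[symmetric] s_def[symmetric] by simp
  have R: "gold_root 1 s = s"
    unfolding gold_root_def
  proof (rule the_equality)
    show "s ^ (2 ^ 1 + 1) = s" using s3 by simp
  next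
    fix z assume "z ^ (2 ^ 1 + 1) = s"
    hence z3: "z ^ 3 = s" by simp
    have "z ^ 2 = z ^ 8 * z" using e[of z] by (simp add: power2_eq_square)
    also have "\<dots> = (z ^ 3) ^ 3" using power_add[of z 8 1] power_mult[of z 3 3] by simp
    finally have "z ^ 2 = s" using z3 s3 by simp
    hence "(z ^ 2) ^ 4 = s" using s4 by simp
    thus "z = s" using e[of z] by (simp flip: power_mult)
  qed
  have s_eq: "s = x ^ 3 + x ^ 6 + x ^ 5"
  proof -
    have "x ^ 12 = x ^ 8 * x ^ 4" by (simp flip: power_add)
    also have "\<dots> = x ^ 5" using e[of x] power_add[of x 1 4] by simp
    finally show ?thesis unfolding s_def tr by (simp flip: power_mult)
  qed
  have "F_prime 3 1 1 x =
      x ^ 3 + s + x ^ 2 * t + x * t ^ 2 + s * (x ^ 2 + t ^ 2 + 1) + s ^ 2 * (x + t)"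
    unfolding F_prime_def Let_def W R ex t_def[symmetric] s_def[symmetric] by (rule refl)
  also have "\<dots> = x ^ 3 + (x ^ 2 + x) * (t + s) + 2 * (s + s * t)"
    unfolding t s by (simp add: algebra_simps)
  also have "\<dots> = x ^ 3 + (x ^ 2 + x) * (t + s)"
    by (simp only: two' add_0_right)
  also have "t = x + x ^ 2 + x ^ 4"
    unfolding t_def by (rule tr)
  also have "x ^ 3 + (x ^ 2 + x) * (x + x ^ 2 + x ^ 4 + s) =
      x ^ 3 + x ^ 2 + x ^ 8 + 2 * (x ^ 3 + x ^ 4 + x ^ 5 + x ^ 6 + x ^ 7)"
    unfolding s_eq by algebra
  also have "\<dots> = x ^ 3 + x ^ 2 + x"
    by (simp only: e two' add_0_right)
  finally show ?thesis .
qed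

lemma EA_equivalent_cube_dim3:
  assumes "CARD('a::{field,finite}) = 2 ^ 3"
  shows "EA_equivalent (F_prime 3 1 1 :: 'a \<Rightarrow> 'a) (\<lambda>x. x powi 3)"
proof -
  have "affine_fun (\<lambda>x::'a. x)"
    unfolding affine_fun_def
    by (intro exI[of _ 1] exI[of _ "\<lambda>_. 1"] exI[of _ 0]) simp
  hence id: "affine_perm (\<lambda>x::'a. x)"
    by (simp add: affine_perm_def bij_def inj_def)
  have A: "affine_fun (\<lambda>x::'a. - (x ^ 2) - x)"
    unfolding affine_fun_def
    by (intro exI[of _ 2] exI[of _ "\<lambda>_. - 1"] exI[of _ 0]) (simp add: numeral_2_eq_2)
  have "(\<lambda>x::'a. x powi 3) = (\<lambda>x. F_prime 3 1 1 x + (- (x ^ 2) - x))"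
    by (rule ext) (simp add: F_prime_dim3[OF assms, unfolded One_nat_def])
  with id A show ?thesis
    unfolding EA_equivalent_def by meson
qed

end

theory Submission
  imports Defs "HOL-Computational_Algebra.Polynomial"
begin

text \<open>
  Write \<open>d = 2 ^ i + 1\<close>, \<open>K\<close> for the subfield with \<open>2 ^ n\<close> elements and \<open>T\<close> for the trace
  onto \<open>K\<close>. The graph of \<open>F'\<close> is the image of the graph of \<open>x \<mapsto> x ^ d\<close> under the linear
  involution \<open>(x, y) \<mapsto> (x + T (x + y), y + T (x + y))\<close>, so the Walsh values
  of \<open>F'\<close> are those of the Gold function, up to a permutation of the arguments.

  For the inequivalence, consider the autocorrelation of \<open>x \<mapsto> tr (b F'(x))\<close>. For
  \<open>b \<in> K - {0}\<close> its support lies in \<open>K\<close>. If \<open>F'\<close> were equivalent to a power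
  permutation, all supports would be related by multiplication with units, and for
  \<open>b \<notin> K\<close> the support could meet every coset of \<open>K\<close> at most once. Computed explicitly,
  the autocorrelation on the coset of \<open>b^(-1/d)\<close> is a Fourier transform over \<open>K\<close>, and Parseval
  then yields \<open>z^(-d) + (z + 1)^(-d) \<in> K\<close> for all \<open>z \<notin> K\<close>. Counting roots of polynomials refutes this
  unless \<open>m = 3\<close>.
\<close>

section \<open>Fields with \<open>2 ^ m\<close> elements, \<open>m\<close> odd\<close>

locale odd_binary_field =
  fixes m :: nat and ty :: "'a::{field,finite} itself"
  assumes card_field: "CARD('a) = 2 ^ m" and odd_m: "odd m"
begin

abbreviation s :: "'a \<Rightarrow> int" where "s \<equiv> trace_sign m"
abbreviation tr :: "'a \<Rightarrow> 'a" where "tr \<equiv> abs_trace m"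

lemma power_field: "x ^ (2 ^ m) = (x::'a)"
  using finite_field_power_card[of x] card_field by simp

text \<open>\<open>power_field\<close> at -1: the exponent is even because \<open>m > 0\<close>,
  which forces characteristic 2.\<close>

lemma minus_one: "- 1 = (1::'a)"
  using power_field[of "- 1"] odd_m by (cases m) auto

lemma minus_self [simp]: "- x = (x::'a)"
  using minus_one by (metis mult_minus1 mult_1)

lemma add_self [simp]: "x + x = (0::'a)"
  using minus_self[of x] by (metis add.right_inverse)

lemma two_eq_0 [simp]: "(2::'a) = 0"
  using add_self[of 1] unfolding one_add_one .

lemma add_self_left [simp]: "x + (x + y) = (y::'a)"
  by (simp flip: add.assoc)

lemma diff_eq_add [simp]: "x - y = x + (y::'a)"
  unfolding diff_conv_add_uminus by simp

lemma add_eq_0_iff_eq: "x + y = 0 \<longleftrightarrow> x = (y::'a)"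
  by (metis add_self add_self_left add_0_right)

lemma of_nat_odd: "odd k \<Longrightarrow> of_nat k = (1::'a)"
  by (elim oddE) simp

lemma frobenius_add: "(x + y) ^ (2 ^ k) = x ^ (2 ^ k) + (y::'a) ^ (2 ^ k)"
proof (induction k)
  case (Suc k)
  have "(u + v)\<^sup>2 = u\<^sup>2 + v\<^sup>2" for u v :: 'a
    by (simp add: power2_eq_square algebra_simps)
  then show ?case
    using Suc by (simp add: power_mult mult.commute[of 2])
qed simp

lemma frobenius_sum: "(\<Sum>j\<in>A. f j) ^ (2 ^ k) = (\<Sum>j\<in>A. (f j :: 'a) ^ (2 ^ k))"
  by (induction A rule: infinite_finite_induct) (simp_all add: frobenius_add)

lemma frobenius_mult_iterate: "x ^ (2 ^ k) = x \<Longrightarrow> x ^ (2 ^ (j * k)) = (x::'a)"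
  by (induction j) (simp_all add: power_add power_mult)

lemma frobenius_add_exp: "x ^ (2 ^ (j + k)) = ((x::'a) ^ (2 ^ j)) ^ (2 ^ k)"
  by (simp add: power_add power_mult)

lemma frobenius_inj: "x ^ (2 ^ k) = y ^ (2 ^ k) \<Longrightarrow> x = (y::'a)"
  using frobenius_add[of x y k] by (simp add: add_eq_0_iff_eq)

text \<open>By Bezout, an element fixed by the Frobenius iterates with indices \<open>k\<close> and
  \<open>m\<close> is fixed by the one with index gcd = 1, so it satisfies
  \<open>x\<^sup>2 = x\<close>.\<close>

lemma frobenius_fixed_coprime:
  assumes "x ^ (2 ^ k) = x" "coprime k m"
  shows "x = 0 \<or> x = (1::'a)"
proof (cases "k = 0")
  case True
  then have "m = 1" using assms(2) by simp
  then have "x\<^sup>2 = x" using power_field[of x] by simp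
  then show ?thesis by (simp add: power2_eq_square)
next
  case False
  then obtain a b where ab: "k * a = m * b + gcd k m"
    using bezout_nat by blast
  then have "x ^ (2 ^ (b * m + 1)) = x"
    using frobenius_mult_iterate[OF assms(1), of a] assms(2) by (simp add: mult.commute)
  then have "x\<^sup>2 = x"
    unfolding frobenius_add_exp using frobenius_mult_iterate[OF power_field, where j = b] by simp
  then show ?thesis by (simp add: power2_eq_square)
qed

lemma rel_trace_add: "rel_trace m n (x + y) = rel_trace m n x + rel_trace m n (y::'a)"
  by (simp add: rel_trace_def frobenius_add sum.distrib)

lemma rel_trace_frobenius: "rel_trace m n (x ^ (2 ^ k)) = rel_trace m n (x::'a) ^ (2 ^ k)"
  by (simp add: rel_trace_def frobenius_sum flip: power_mult)
    (simp add: mult.commute)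

text \<open>The power map shifts the summands cyclically: the last one becomes
  \<open>x ^ (2 ^ m) = x\<close>, the first.\<close>

lemma rel_trace_fixed:
  assumes "n dvd m"
  shows "rel_trace m n x ^ (2 ^ n) = rel_trace m n (x::'a)"
proof -
  define f where "f k = x ^ (2 ^ (k * n))" for k
  have m: "m div n * n = m" using assms by simp
  have "rel_trace m n x ^ (2 ^ n) = (\<Sum>k<m div n. f (Suc k))"
    by (simp add: rel_trace_def frobenius_sum f_def add.commute flip: frobenius_add_exp)
  also have "\<dots> + f 0 = (\<Sum>k<Suc (m div n). f k)"
    unfolding sum.lessThan_Suc_shift by (simp add: add.commute)
  then have "(\<Sum>k<m div n. f (Suc k)) = (\<Sum>k<m div n. f k)"
    using power_field[of x] by (simp add: f_def m)
  finally show ?thesis by (simp add: rel_trace_def f_def)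
qed

lemma abs_trace_eq_rel_trace: "tr = rel_trace m 1"
  by (simp add: fun_eq_iff abs_trace_def rel_trace_def)

lemma tr_add: "tr (x + y) = tr x + tr y"
  by (simp add: abs_trace_eq_rel_trace rel_trace_add)

lemma tr_0 [simp]: "tr 0 = 0"
  by (simp add: abs_trace_def power_0_left)

lemma tr_frobenius: "tr (x ^ (2 ^ k)) = tr x"
proof -
  have "tr x ^ (2 ^ 1) = tr x"
    unfolding abs_trace_eq_rel_trace by (rule rel_trace_fixed) simp
  then show ?thesis
    using frobenius_mult_iterate[of "tr x" 1 k]
    by (simp add: abs_trace_eq_rel_trace rel_trace_frobenius)
qed

lemma tr_cases: "tr x = 0 \<or> tr x = 1"
proof -
  have "tr x ^ (2 ^ 1) = tr x"
    unfolding abs_trace_eq_rel_trace by (rule rel_trace_fixed) simp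
  then show ?thesis by (rule frobenius_fixed_coprime) simp
qed

lemma s_add: "s (x + y) = s x * s y"
  using tr_cases[of x] tr_cases[of y] by (auto simp: trace_sign_def tr_add)

lemma s_cases: "s x = 1 \<or> s x = - 1"
  by (simp add: trace_sign_def)

lemma s_square [simp]: "s x * s x = 1"
  using s_cases[of x] by auto

lemma s_0 [simp]: "s 0 = 1"
  by (simp add: trace_sign_def)

lemma s_1: "s 1 = - 1"
  using odd_m by (simp add: trace_sign_def abs_trace_def of_nat_odd)

lemma s_cong: "tr x = tr y \<Longrightarrow> s x = s y"
  by (simp add: trace_sign_def)

lemma s_frobenius: "s (x ^ (2 ^ k)) = s x"
  by (intro s_cong tr_frobenius)

text \<open>Translation by \<open>h\<close> permutes \<open>H\<close> and flips the sign of every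
  summand, so the sum equals its own negative.\<close>

lemma sum_s_eq_0:
  assumes "\<And>x. x \<in> H \<Longrightarrow> x + h \<in> H" "s (h * w) = - 1"
  shows "(\<Sum>x\<in>H. s (x * w)) = 0"
proof -
  have "bij_betw (\<lambda>x. x + h) H H"
    by (rule bij_betw_byWitness[where f' = "\<lambda>x. x + h"])
      (auto simp: assms add.assoc)
  then have "(\<Sum>x\<in>H. s (x * w)) = (\<Sum>x\<in>H. s ((x + h) * w))"
    by (rule sum.reindex_bij_betw[symmetric])
  also have "\<dots> = - (\<Sum>x\<in>H. s (x * w))"
    by (simp add: distrib_right s_add assms(2) sum_negf)
  finally show ?thesis by simp
qed

text \<open>For nonzero \<open>w\<close> the translation by \<open>1 / w\<close> flips signs, since
  \<open>s 1 = - 1\<close> for odd \<open>m\<close>.\<close>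

lemma sum_s: "(\<Sum>x\<in>UNIV. s (x * w)) = (if w = 0 then 2 ^ m else 0)"
  using sum_s_eq_0[of UNIV "1 / w" w] by (simp add: card_field s_1)

lemma tr_nondegenerate:
  assumes "\<And>x. s (x * w) = 1"
  shows "w = 0"
  using assms[of "1 / w"] s_1 by (cases "w = 0") auto

lemma sum_shift: "(\<Sum>x\<in>UNIV. f (x + y)) = (\<Sum>x\<in>UNIV. f (x :: 'a))" for f :: "'a \<Rightarrow> 'b::comm_monoid_add"
proof (rule sum.reindex_bij_betw)
  show "bij (\<lambda>x. x + y)"
    by (rule bij_betw_byWitness[where f' = "\<lambda>x. x + y"]) (auto simp: add.assoc)
qed

section \<open>Autocorrelation and its duality with the Walsh transform\<close>

definition autocorr :: "('a \<Rightarrow> 'a) \<Rightarrow> 'a \<Rightarrow> 'a \<Rightarrow> int"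
  where "autocorr F b y = (\<Sum>x\<in>UNIV. s (b * (F (x + y) + F x)))"

text \<open>Wiener-Khinchin: grouping the pairs in the double sum by their difference
  \<open>y\<close> exhibits the squared Walsh transform as the Fourier transform of the
  autocorrelation.\<close>

lemma walsh_square: "(walsh m F a b)\<^sup>2 = (\<Sum>y\<in>UNIV. autocorr F b y * s (a * y))"
proof -
  have "(walsh m F a b)\<^sup>2 = (\<Sum>x\<in>UNIV. \<Sum>y\<in>UNIV. s (b * F x + a * x) * s (b * F y + a * y))"
    by (simp add: walsh_def power2_eq_square sum_product)
  also have "\<dots> = (\<Sum>x\<in>UNIV. \<Sum>y\<in>UNIV. s (b * F x + a * x) * s (b * F (y + x) + a * (y + x)))"
    by (intro sum.cong refl sum_shift[symmetric])
  also have "\<dots> = (\<Sum>x\<in>UNIV. \<Sum>y\<in>UNIV. s (b * (F (x + y) + F x)) * s (a * y))"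
    unfolding s_add[symmetric] by (simp add: algebra_simps)
  also have "\<dots> = (\<Sum>y\<in>UNIV. \<Sum>x\<in>UNIV. s (b * (F (x + y) + F x)) * s (a * y))"
    by (rule sum.swap)
  finally show ?thesis by (simp add: autocorr_def sum_distrib_right)
qed

text \<open>Fourier inversion of \<open>walsh_square\<close>: summing over \<open>a\<close> leaves
  only the term at \<open>x = y\<close>.\<close>

lemma autocorr_eq: "2 ^ m * autocorr F b y = (\<Sum>a\<in>UNIV. (walsh m F a b)\<^sup>2 * s (a * y))"
proof -
  have "(\<Sum>a\<in>UNIV. (walsh m F a b)\<^sup>2 * s (a * y))
      = (\<Sum>a\<in>UNIV. \<Sum>x\<in>UNIV. autocorr F b x * s (a * (x + y)))"
    unfolding walsh_square sum_distrib_right by (simp add: distrib_left s_add mult.assoc)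
  also have "\<dots> = (\<Sum>x\<in>UNIV. autocorr F b x * (\<Sum>a\<in>UNIV. s (a * (x + y))))"
    by (subst sum.swap) (simp add: sum_distrib_left)
  also have "\<dots> = (\<Sum>x\<in>UNIV. if x = y then autocorr F b x * 2 ^ m else 0)"
    unfolding sum_s by (intro sum.cong) (auto simp: add_eq_0_iff_eq)
  finally show ?thesis by simp
qed

lemma sum_walsh: "(\<Sum>a\<in>UNIV. walsh m F a b) = 2 ^ m * s (b * F 0)"
proof -
  have "(\<Sum>a\<in>UNIV. walsh m F a b) = (\<Sum>x\<in>UNIV. s (b * F x) * (\<Sum>a\<in>UNIV. s (a * x)))"
    unfolding walsh_def by (subst sum.swap) (simp add: s_add sum_distrib_left)
  also have "\<dots> = (\<Sum>x\<in>UNIV. if x = 0 then s (b * F x) * 2 ^ m else 0)"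
    unfolding sum_s by (intro sum.cong) auto
  finally show ?thesis by simp
qed

section \<open>Autocorrelation and EA-equivalence\<close>

lemma affine_fun_add:
  assumes "affine_fun A"
  shows "A (x + y) = A x + (A y + A (0::'a))"
proof -
  obtain N c d where A: "\<And>x. A x = (\<Sum>j<(N::nat). c j * x ^ (2 ^ j)) + (d::'a)"
    using assms unfolding affine_fun_def by blast
  have "d = A 0" by (simp add: A power_0_left)
  then show ?thesis
    by (simp add: A frobenius_add distrib_left sum.distrib ac_simps)
qed

text \<open>Adjoint of the linear part for the trace form. Applying the Frobenius map
  \<open>j * (m - 1)\<close> times leaves the trace unchanged and turns \<open>x ^ (2 ^ j)\<close>
  into \<open>x ^ (2 ^ (j * m)) = x\<close>.\<close>

lemma affine_fun_adjoint:
  assumes "affine_fun A"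
  shows "\<exists>B. \<forall>b x. s (b * (A x + A 0)) = s (B b * (x::'a))"
proof -
  obtain N c d where A: "\<And>x. A x = (\<Sum>j<(N::nat). c j * x ^ (2 ^ j)) + (d::'a)"
    using assms unfolding affine_fun_def by blast
  define B where "B b = (\<Sum>j<N. (b * c j) ^ (2 ^ (j * (m - 1))))" for b
  have "m = Suc (m - 1)" using odd_m by (cases m) auto
  have "tr (b * (A x + A 0)) = tr (B b * x)" for b x
  proof -
    have lin: "A x + A 0 = (\<Sum>j<N. c j * x ^ (2 ^ j))"
      by (simp add: A power_0_left add.assoc)
    have tr_sum: "tr (sum f I) = (\<Sum>j\<in>I. tr (f j))" for f and I :: "nat set"
      by (induction I rule: infinite_finite_induct) (simp_all add: tr_add)
    have "tr (b * (c j * x ^ (2 ^ j))) = tr ((b * c j) ^ (2 ^ (j * (m - 1))) * x)" for j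
    proof -
      have "j + j * (m - 1) = j * m"
        by (subst (2) \<open>m = Suc (m - 1)\<close>) simp
      then have "(x ^ (2 ^ j)) ^ (2 ^ (j * (m - 1))) = x"
        by (metis frobenius_add_exp frobenius_mult_iterate power_field)
      then show ?thesis
        using tr_frobenius[of "b * (c j * x ^ (2 ^ j))" "j * (m - 1)"]
        by (simp add: power_mult_distrib mult.assoc)
    qed
    then show ?thesis
      by (simp add: lin B_def sum_distrib_left sum_distrib_right tr_sum)
  qed
  then show ?thesis by (metis s_cong)
qed

lemma affine_perm_linear_part:
  assumes "affine_perm A"
  shows "inj (\<lambda>x. A x + A (0::'a))" "surj (\<lambda>x. A x + A (0::'a))"
proof -
  show "inj (\<lambda>x. A x + A 0)"
    using assms by (auto simp: affine_perm_def bij_def inj_def)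
  then show "surj (\<lambda>x. A x + A 0)"
    by (simp add: finite_UNIV_inj_surj)
qed

text \<open>Differences see only linear parts: \<open>A\<close> contributes a term independent of
  \<open>x\<close>, and \<open>A2\<close> changes the shift \<open>y\<close> into
  \<open>A2 y + A2 0\<close>.\<close>

lemma EA_equivalent_derivative:
  assumes "affine_fun A1" "affine_fun A2" "affine_fun A" "P = (\<lambda>x. A1 (F (A2 x)) + A (x::'a))"
  shows "P (x + y) + P x
    = (A1 (F (A2 x + (A2 y + A2 0)) + F (A2 x)) + A1 0) + (A y + A 0)"
proof -
  have "A1 (F (A2 x + (A2 y + A2 0)) + F (A2 x)) + A1 0
    = A1 (F (A2 x + (A2 y + A2 0))) + A1 (F (A2 x))"
    using affine_fun_add[OF assms(1)] by (simp add: add.assoc)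
  moreover have "P (x + y) + P x
    = A1 (F (A2 x + (A2 y + A2 0))) + A1 (F (A2 x)) + (A (x + y) + A x)"
    using affine_fun_add[OF assms(2)] by (simp add: assms(4) ac_simps)
  moreover have "A (x + y) + A x = A y + A 0"
    using affine_fun_add[OF assms(3), of x y] by (simp add: ac_simps)
  ultimately show ?thesis by simp
qed

text \<open>Take for \<open>\<beta>\<close> the adjoint of the linear part of \<open>A1\<close> and
  for \<open>L\<close> the linear part of \<open>A2\<close>. The summand \<open>A\<close> only
  contributes a sign, so the supports correspond.\<close>

lemma EA_equivalent_autocorr:
  assumes "EA_equivalent F P"
  obtains \<beta> L :: "'a \<Rightarrow> 'a"
  where "inj \<beta>" "\<beta> 0 = 0" "inj L" "\<And>x y. L (x + y) = L x + L y"
    "\<And>b y. autocorr P b y \<noteq> 0 \<longleftrightarrow> autocorr F (\<beta> b) (L y) \<noteq> 0"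
proof -
  obtain A1 A2 A where A: "affine_perm A1" "affine_perm A2" "affine_fun A"
    and P: "P = (\<lambda>x. A1 (F (A2 x)) + A x)"
    using assms unfolding EA_equivalent_def by blast
  note aff = A(1,2)[unfolded affine_perm_def, THEN conjunct1]
  obtain \<beta> where \<beta>: "\<And>b x. s (b * (A1 x + A1 0)) = s (\<beta> b * x)"
    using affine_fun_adjoint[OF aff(1)] by blast
  define L where "L y = A2 y + A2 0" for y
  have "inj \<beta>"
  proof
    fix b c assume "\<beta> b = \<beta> c"
    then have *: "s (b * (A1 x + A1 0)) = s (c * (A1 x + A1 0))" for x
      using \<beta> by metis
    have "s (w * (b + c)) = 1" for w
    proof -
      obtain x where w: "w = A1 x + A1 0"
        using surjD[OF affine_perm_linear_part(2)[OF A(1)], of w] by blast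
      have "s (w * (b + c)) = s (b * w) * s (c * w)"
        by (simp add: distrib_left s_add mult.commute)
      then show ?thesis unfolding w * by simp
    qed
    then show "b = c" using tr_nondegenerate[of "b + c"] by (simp add: add_eq_0_iff_eq)
  qed
  moreover have "\<beta> 0 = 0"
    using \<beta>[of 0] by (intro tr_nondegenerate) (simp add: mult.commute)
  moreover have "inj L" "L (x + y) = L x + L y" for x y
    using affine_perm_linear_part(1)[OF A(2)] affine_fun_add[OF aff(2), of x y]
    by (simp_all add: L_def[abs_def] ac_simps)
  moreover have "autocorr P b y = s (b * (A y + A 0)) * autocorr F (\<beta> b) (L y)" for b y
  proof -
    have "autocorr P b y
        = (\<Sum>x\<in>UNIV. s (b * (A y + A 0)) * s (\<beta> b * (F (A2 x + L y) + F (A2 x))))"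
      unfolding autocorr_def EA_equivalent_derivative[OF aff A(3) P] L_def[symmetric]
      unfolding distrib_left[of b _ "A y + A 0"] s_add \<beta> by (simp add: mult.commute)
    also have "\<dots> = (\<Sum>x\<in>UNIV. s (b * (A y + A 0)) * s (\<beta> b * (F (x + L y) + F x)))"
      using A(2) by (intro sum.reindex_bij_betw[of A2]) (simp add: affine_perm_def)
    finally show ?thesis by (simp add: autocorr_def sum_distrib_left)
  qed
  then have "autocorr P b y \<noteq> 0 \<longleftrightarrow> autocorr F (\<beta> b) (L y) \<noteq> 0" for b y
    using s_cases[of "b * (A y + A 0)"] by auto
  ultimately show thesis by (rule that)
qed

section \<open>APN functions and power permutations\<close>

definition apn :: "('a \<Rightarrow> 'a) \<Rightarrow> bool"
  where "apn F \<longleftrightarrow> (\<forall>x y z. y \<noteq> 0 \<longrightarrow> F (x + y) + F x = F (z + y) + F z \<longrightarrow> x = z \<or> x = z + y)"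

lemma EA_equivalent_apn:
  assumes "EA_equivalent F P" "apn F"
  shows "apn P"
  unfolding apn_def
proof (intro allI impI)
  fix x y z assume y: "y \<noteq> 0" and eq: "P (x + y) + P x = P (z + y) + P z"
  obtain A1 A2 A where A: "affine_perm A1" "affine_perm A2" "affine_fun A"
    and P: "P = (\<lambda>x. A1 (F (A2 x)) + A x)"
    using assms unfolding EA_equivalent_def by blast
  note aff = A(1,2)[unfolded affine_perm_def, THEN conjunct1]
  have inj: "A1 u + A1 0 = A1 v + A1 0 \<Longrightarrow> u = v" "A2 u + A2 0 = A2 v + A2 0 \<Longrightarrow> u = v" for u v
    using injD[OF affine_perm_linear_part(1)[OF A(1)]] injD[OF affine_perm_linear_part(1)[OF A(2)]]
    by blast+
  have "F (A2 x + (A2 y + A2 0)) + F (A2 x) = F (A2 z + (A2 y + A2 0)) + F (A2 z)"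
    using eq unfolding EA_equivalent_derivative[OF aff A(3) P] add_right_cancel[of _ "A y + A 0"]
    by (rule inj(1))
  moreover have "A2 y + A2 0 \<noteq> 0"
    using inj(2)[of y 0] y add_self[of "A2 0"] by metis
  ultimately have "A2 x = A2 z \<or> A2 x = A2 z + (A2 y + A2 0)"
    using assms(2) unfolding apn_def by blast
  then have "A2 x = A2 z \<or> A2 x = A2 (z + y)"
    by (simp add: affine_fun_add[OF aff(2)])
  then show "x = z \<or> x = z + y"
    using A(2) by (auto simp: affine_perm_def bij_def inj_def)
qed

text \<open>If \<open>v powi k = 1\<close> and \<open>v\<close> is not 1, then
  \<open>x = inverse (v + 1)\<close> satisfies \<open>x + 1 = v * x\<close>, so the derivative in
  direction 1 vanishes at \<open>x\<close>. Comparing the zeros for \<open>v = w\<close> and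
  \<open>v = w\<^sup>2\<close> gives \<open>w = w\<^sup>2\<close> or \<open>w ^ 3 = 1\<close>. In
  odd degree there is no subfield with 4 elements, so only \<open>w = 1\<close> remains.\<close>

lemma apn_power_kernel:
  fixes k :: int
  assumes "apn (\<lambda>x. x powi k)" "w \<noteq> 0" "w powi k = 1"
  shows "w = (1::'a)"
proof (rule ccontr)
  assume "w \<noteq> 1"
  then have "w\<^sup>2 \<noteq> 1"
    by (metis add_self add_eq_0_iff_eq frobenius_inj power_one power_one_right)
  have deriv: "(x + 1) powi k + x powi k = 0" and step: "x + 1 = v * x"
    if "x = inverse (v + 1)" "v \<noteq> 1" "v powi k = 1" for x v :: 'a
  proof -
    have "(v + 1) * x = 1" using that by (simp add: add_eq_0_iff_eq)
    then show "x + 1 = v * x" by (metis add.commute add_self_left distrib_right mult_1)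
    then show "(x + 1) powi k + x powi k = 0"
      using that by (simp add: power_int_mult_distrib)
  qed
  define x z where "x = inverse (w + 1)" and "z = inverse (w\<^sup>2 + 1)"
  have w2: "w\<^sup>2 powi k = 1"
    using assms(3) by (simp add: power2_eq_square power_int_mult_distrib)
  have "(x + 1) powi k + x powi k = (z + 1) powi k + z powi k"
    using deriv[OF x_def \<open>w \<noteq> 1\<close> assms(3)] deriv[OF z_def \<open>w\<^sup>2 \<noteq> 1\<close> w2] by simp
  then have "x = z \<or> x = z + 1"
    using assms(1) unfolding apn_def by (metis zero_neq_one)
  then have "x = z \<or> x = w\<^sup>2 * z"
    using step[OF z_def \<open>w\<^sup>2 \<noteq> 1\<close> w2] by simp
  then have "w ^ (2 ^ 2) = w"
  proof
    assume "x = z"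
    then have "w = w\<^sup>2" by (simp add: x_def z_def)
    then have "w = 1" using \<open>w \<noteq> 0\<close> by (simp add: power2_eq_square)
    then show ?thesis by simp
  next
    assume "x = w\<^sup>2 * z"
    moreover have "w + 1 \<noteq> 0" "w\<^sup>2 + 1 \<noteq> 0"
      using \<open>w \<noteq> 1\<close> \<open>w\<^sup>2 \<noteq> 1\<close> by (simp_all add: add_eq_0_iff_eq)
    ultimately have "w\<^sup>2 + 1 = w\<^sup>2 * (w + 1)"
      by (simp add: x_def z_def field_simps)
    then have "w\<^sup>2 * w = 1" by (simp add: distrib_left)
    then show ?thesis by (simp add: power2_eq_square eval_nat_numeral mult.assoc)
  qed
  then have "w = 0 \<or> w = 1"
    by (rule frobenius_fixed_coprime) (use odd_m in simp)
  then show False using \<open>w \<noteq> 0\<close> \<open>w \<noteq> 1\<close> by simp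
qed

text \<open>Trivial kernel makes the power map a permutation of the nonzero elements, so
  \<open>c / b\<close> is a \<open>k\<close>-th power.\<close>

lemma apn_power_surj:
  fixes k :: int
  assumes "apn (\<lambda>x. x powi k)" "b \<noteq> 0" "c \<noteq> 0"
  shows "\<exists>e::'a. e \<noteq> 0 \<and> c = b * e powi k"
proof -
  have "inj_on (\<lambda>x. x powi k) (UNIV - {0::'a})"
  proof (rule inj_onI)
    fix x y :: 'a assume xy: "x \<in> UNIV - {0}" "y \<in> UNIV - {0}" "x powi k = y powi k"
    then have nz: "x \<noteq> 0" "y \<noteq> 0" "y powi k \<noteq> 0" by simp_all
    have "(x / y) powi k = 1"
      unfolding power_int_divide_distrib xy(3) using nz(3) by (rule divide_self)
    then have "x / y = 1" by (rule apn_power_kernel[OF assms(1), rotated]) (simp add: nz)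
    then show "x = y" using nz(2) by (simp only: divide_eq_1_iff)
  qed
  then have "(\<lambda>x. x powi k) ` (UNIV - {0::'a}) = UNIV - {0}"
    by (intro endo_inj_surj) auto
  moreover have "c / b \<in> UNIV - {0}" using assms by simp
  ultimately have "c / b \<in> (\<lambda>x. x powi k) ` (UNIV - {0::'a})" by simp
  then obtain e where "e \<noteq> 0" "c / b = e powi k" by blast
  then have "c = b * e powi k" using assms(2) by (simp add: field_simps)
  then show ?thesis using \<open>e \<noteq> 0\<close> by blast
qed

lemma autocorr_power:
  fixes k :: int and e :: 'a
  assumes "e \<noteq> 0"
  shows "autocorr (\<lambda>x. x powi k) (b * e powi k) y = autocorr (\<lambda>x. x powi k) b (e * y)"
proof -
  have "bij ((*) e)"
    by (rule bij_betw_byWitness[where f' = "(*) (inverse e)"])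
      (use assms in \<open>auto simp flip: mult.assoc\<close>)
  then have "autocorr (\<lambda>x. x powi k) b (e * y)
      = (\<Sum>x\<in>UNIV. s (b * ((e * x + e * y) powi k + (e * x) powi k)))"
    unfolding autocorr_def by (rule sum.reindex_bij_betw[symmetric])
  also have "\<dots> = autocorr (\<lambda>x. x powi k) (b * e powi k) y"
    unfolding autocorr_def distrib_left[of e, symmetric] power_int_mult_distrib
    by (simp add: distrib_left mult.assoc)
  finally show ?thesis by (rule sym)
qed

text \<open>
  The supports of the autocorrelations of a power permutation are the multiples
  of one set by units. If those belonging to the nonzero elements of a subgroup
  \<open>H\<close> lie in \<open>H\<close>, then quotients of elements of one support stabilise a subgroup corresponding
  to \<open>H\<close>, so every other support contains at most one element of each coset of \<open>H\<close>.
\<close>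

lemma EA_equivalent_power_autocorr_support:
  fixes k :: int
  assumes EA: "EA_equivalent F (\<lambda>x. x powi k)" and "apn F"
    and H: "0 \<in> H" "\<And>x y. x \<in> H \<Longrightarrow> y \<in> H \<Longrightarrow> x + y \<in> H"
    and support: "\<And>b y. b \<in> H \<Longrightarrow> b \<noteq> 0 \<Longrightarrow> autocorr F b y \<noteq> 0 \<Longrightarrow> y \<in> H"
    and b: "b \<notin> H" and y: "y \<noteq> 0" "autocorr F b y \<noteq> 0"
    and y': "y' \<noteq> 0" "autocorr F b y' \<noteq> 0" and sum: "y + y' \<in> H"
  shows "y = (y'::'a)"
proof (rule ccontr)
  assume "y \<noteq> y'"
  have apn: "apn (\<lambda>x. x powi k)" by (rule EA_equivalent_apn) fact+
  obtain \<beta> L where \<beta>: "inj \<beta>" "\<beta> 0 = (0::'a)" and L: "inj L" "\<And>x y. L (x + y) = L x + (L y::'a)"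
    and ac: "\<And>b y. autocorr (\<lambda>x. x powi k) b y \<noteq> 0 \<longleftrightarrow> autocorr F (\<beta> b) (L y) \<noteq> 0"
    using EA_equivalent_autocorr[OF EA] by blast
  have surj: "surj \<beta>" "surj L"
    using \<beta>(1) L(1) by (simp_all add: finite_UNIV_inj_surj)
  have L0: "L 0 = 0" using L(2)[of 0 0] by simp
  have \<beta>_0: "\<beta> x = 0 \<longleftrightarrow> x = 0" and L_0: "L x = 0 \<longleftrightarrow> x = 0" for x
    using \<beta> L L0 by (metis injD)+
  \<comment> \<open>\<open>B\<close> collects the coefficients and \<open>U\<close> the shifts of
    the power function that correspond to nonzero elements of \<open>H\<close>; for \<open>c\<close>
    in \<open>B\<close> every nonzero support point lies in \<open>U\<close>.\<close>
  define U where "U = L -` (H - {0})"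
  define B where "B = \<beta> -` (H - {0})"
  have "card B = card U"
    using \<beta>(1) L(1) surj by (simp add: U_def B_def card_vimage_inj)
  obtain b0 where b0: "b = \<beta> b0" using surj by (metis surjD)
  obtain v where v: "y = L v" using surj by (metis surjD)
  obtain v' where v': "y' = L v'" using surj by (metis surjD)
  have "b0 \<noteq> 0" using b H(1) b0 \<beta>(2) by metis
  have "v \<noteq> 0" "v' \<noteq> 0" using y(1) y'(1) v v' L0 by metis+
  have "\<exists>e. e \<noteq> 0 \<and> c = b0 * e powi k" if "c \<in> B" for c
  proof (rule apn_power_surj[OF apn \<open>b0 \<noteq> 0\<close>])
    show "c \<noteq> 0" using that by (auto simp: B_def \<beta>_0)
  qed
  then have "\<exists>e. \<forall>c\<in>B. e c \<noteq> 0 \<and> c = b0 * e c powi k"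
    by (intro bchoice) blast
  then obtain e where e: "\<And>c. c \<in> B \<Longrightarrow> e c \<noteq> 0" "\<And>c. c \<in> B \<Longrightarrow> c = b0 * e c powi k"
    by blast
  \<comment> \<open>Rescaling carries the support at \<open>b0\<close> to the support at
    \<open>c\<close>, so each \<open>w / e c\<close> lies in \<open>U\<close>. Distinct
    \<open>c\<close> give distinct quotients, and the equal cardinalities then make the map onto
    \<open>U\<close>.\<close>
  have image: "(\<lambda>c. w / e c) ` B = U" if w: "w \<noteq> 0" "autocorr (\<lambda>x. x powi k) b0 w \<noteq> 0" for w
  proof (rule card_subset_eq)
    show "(\<lambda>c. w / e c) ` B \<subseteq> U"
    proof
      fix u assume "u \<in> (\<lambda>c. w / e c) ` B"
      then obtain c where c: "c \<in> B" "u = w / e c" by auto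
      have "autocorr (\<lambda>x. x powi k) c u = autocorr (\<lambda>x. x powi k) b0 w"
        using autocorr_power[OF e(1)[OF c(1)], of k b0 u] e[OF c(1)] c(2) by simp
      then have "autocorr F (\<beta> c) (L u) \<noteq> 0" using w(2) ac by metis
      then show "u \<in> U"
        using support[of "\<beta> c" "L u"] c e(1)[OF c(1)] w(1) by (auto simp: B_def U_def L_0)
    qed
    have "inj_on (\<lambda>c. w / e c) B"
    proof (rule inj_onI)
      fix c c' assume cc': "c \<in> B" "c' \<in> B" "w / e c = w / e c'"
      then have "e c = e c'" using e(1) w(1) by (simp add: field_simps)
      then show "c = c'" using e(2) cc' by metis
    qed
    then show "card ((\<lambda>c. w / e c) ` B) = card U"
      by (simp add: card_image \<open>card B = card U\<close>)
  qed simp_all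
  have ac_b0: "autocorr (\<lambda>x. x powi k) b0 v \<noteq> 0" "autocorr (\<lambda>x. x powi k) b0 v' \<noteq> 0"
    using y(2) y'(2) ac b0 v v' by auto
  \<comment> \<open>Both \<open>v / e c\<close> and \<open>v' / e c\<close> run through all of
    \<open>U\<close>, so multiplication by \<open>q\<close> preserves \<open>U\<close>.\<close>
  define q where "q = v' / v"
  have q_mult: "q * u \<in> U" if "u \<in> U" for u
  proof -
    have "u \<in> (\<lambda>c. v / e c) ` B"
      using that image[OF \<open>v \<noteq> 0\<close> ac_b0(1)] by simp
    then obtain c where "c \<in> B" "u = v / e c" by blast
    then have "q * u = v' / e c" using \<open>v \<noteq> 0\<close> by (simp add: q_def)
    then show ?thesis using image[OF \<open>v' \<noteq> 0\<close> ac_b0(2)] \<open>c \<in> B\<close> by auto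
  qed
  have "1 + q \<noteq> 0"
    using \<open>y \<noteq> y'\<close> \<open>v \<noteq> 0\<close> by (auto simp: q_def v v' add_eq_0_iff_eq)
  \<comment> \<open>Since \<open>H\<close> is closed under addition, multiplication by
    \<open>1 + q\<close> preserves \<open>U\<close> as well and permutes it. As it sends
    \<open>v\<close> to \<open>v + v'\<close>, which lies in \<open>U\<close>, already
    \<open>v\<close> lies in \<open>U\<close>.\<close>
  have "(\<lambda>u. (1 + q) * u) ` U = U"
  proof (rule endo_inj_surj)
    show "(\<lambda>u. (1 + q) * u) ` U \<subseteq> U"
    proof
      fix x assume "x \<in> (\<lambda>u. (1 + q) * u) ` U"
      then obtain u where u: "u \<in> U" "x = u + q * u" by (auto simp: distrib_right)
      have "x = (1 + q) * u" using u by (simp add: distrib_right)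
      moreover have "u \<noteq> 0" using u(1) by (auto simp: U_def L_0)
      ultimately have "x \<noteq> 0" using \<open>1 + q \<noteq> 0\<close> by simp
      moreover have "L x \<in> H"
        using u q_mult[OF u(1)] H(2) by (simp add: U_def L(2))
      ultimately show "x \<in> U" by (simp add: U_def L_0)
    qed
    show "inj_on (\<lambda>u. (1 + q) * u) U"
      using \<open>1 + q \<noteq> 0\<close> by (simp add: inj_on_def)
  qed simp
  moreover have "(1 + q) * v = v + v'" using \<open>v \<noteq> 0\<close> by (simp add: q_def distrib_right)
  moreover have "v + v' \<in> U"
    using sum \<open>y \<noteq> y'\<close> by (simp add: U_def L(2) v v' add_eq_0_iff_eq)
  ultimately have "(1 + q) * v \<in> (\<lambda>u. (1 + q) * u) ` U" by simp
  then have "v \<in> U" using \<open>1 + q \<noteq> 0\<close> by auto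
  \<comment> \<open>Now \<open>image\<close> represents \<open>v\<close> itself as a quotient
    \<open>v / e c\<close>. This forces \<open>e c = 1\<close> and \<open>c = b0\<close>,
    contradicting that \<open>b\<close> is outside \<open>H\<close>.\<close>
  then have "v \<in> (\<lambda>c. v / e c) ` B"
    using image[OF \<open>v \<noteq> 0\<close> ac_b0(1)] by simp
  then obtain c where c: "c \<in> B" "v = v / e c" by blast
  then have "e c = 1" using \<open>v \<noteq> 0\<close> e(1)[OF c(1)] by (simp add: field_simps)
  then have "c = b0" using e(2)[OF c(1)] by simp
  then show False using c(1) b b0 by (simp add: B_def)
qed

end

section \<open>The Gold function and the relative trace\<close>

locale gold_setup = odd_binary_field m ty
  for m :: nat and ty :: "'a::{field,finite} itself" +
  fixes n i :: nat
  assumes n_dvd: "n dvd m" and n_neq: "n \<noteq> m" and coprime_i: "coprime m i"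
begin

abbreviation T :: "'a \<Rightarrow> 'a" where "T \<equiv> rel_trace m n"

definition sub :: "'a set" where "sub = {x. x ^ (2 ^ n) = x}"
definition ker :: "'a set" where "ker = {x. T x = 0}"
definition sg :: "'a \<Rightarrow> 'a" where "sg x = x ^ (2 ^ i)"
definition gold :: "'a \<Rightarrow> 'a" where "gold x = sg x * x"
text \<open>This is \<open>b\<close> to the power \<open>- 1 / (2 ^ i + 1)\<close>, the scaling
  factor with \<open>b * gold (g b * x) = gold x\<close> for nonzero \<open>b\<close>.\<close>

definition g :: "'a \<Rightarrow> 'a" where "g b = inverse (gold_root i b)"

lemma n_pos: "n > 0"
  using n_dvd odd_m by (cases n) auto

lemma sg_0 [simp]: "sg 0 = 0" and sg_1 [simp]: "sg 1 = 1"
  by (simp_all add: sg_def)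

lemma sg_add: "sg (x + y) = sg x + sg y"
  by (simp add: sg_def frobenius_add)

lemma sg_mult: "sg (x * y) = sg x * sg y" and sg_inverse: "sg (inverse x) = inverse (sg x)"
  by (simp_all add: sg_def power_mult_distrib power_inverse)

lemma s_sg: "s (sg x) = s x"
  by (simp add: sg_def s_frobenius)

lemma bij_sg: "bij sg"
proof -
  have "inj sg" by (rule injI) (metis sg_def frobenius_inj)
  then show ?thesis by (simp add: bij_def finite_UNIV_inj_surj)
qed

text \<open>Two applications of \<open>sg\<close> are the Frobenius iterate with index
  \<open>2 * i\<close>, which is coprime to the odd number \<open>m\<close>.\<close>

lemma sg_sg_fixed: "sg (sg x) = x \<longleftrightarrow> x = 0 \<or> x = 1"
proof
  assume "sg (sg x) = x"
  then have "x ^ (2 ^ (2 * i)) = x"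
    by (simp add: sg_def mult_2 frobenius_add_exp)
  moreover have "coprime (2 * i) m"
    using coprime_i odd_m by (simp add: coprime_commute)
  ultimately show "x = 0 \<or> x = 1" by (rule frobenius_fixed_coprime)
qed auto

lemma gold_power: "gold x = x ^ (2 ^ i + 1)"
  by (simp add: gold_def sg_def)

lemma gold_0 [simp]: "gold 0 = 0" and gold_1 [simp]: "gold 1 = 1"
  by (simp_all add: gold_def)

lemma gold_eq_0_iff [simp]: "gold x = 0 \<longleftrightarrow> x = 0"
  by (simp add: gold_power)

lemma gold_add: "gold (x + y) = gold x + gold y + (sg x * y + x * sg y)"
  by (simp add: gold_def sg_add algebra_simps)

lemma gold_mult: "gold (x * y) = gold x * gold y"
  by (simp add: gold_def sg_mult ac_simps)

lemma gold_inverse: "gold (inverse x) = inverse (gold x)"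
  by (simp add: gold_def sg_inverse)

text \<open>The quotient \<open>w\<close> of two nonzero elements with equal image satisfies
  \<open>sg w = inverse w\<close>, hence \<open>sg (sg w) = w\<close>.\<close>

lemma gold_eq_iff [simp]: "gold x = gold y \<longleftrightarrow> x = y"
proof
  assume eq: "gold x = gold y"
  show "x = y"
  proof (cases "y = 0")
    case True
    then show ?thesis using eq by simp
  next
    case False
    define w where "w = x * inverse y"
    have "gold w = 1" using eq False by (simp add: w_def gold_mult gold_inverse)
    then have w: "sg w = inverse w"
      by (metis gold_def inverse_unique mult.commute)
    then have "sg (sg w) = w" by (simp add: sg_inverse)
    then have "w = 1"
      using sg_sg_fixed \<open>gold w = 1\<close> by fastforce
    then show ?thesis using False by (simp add: w_def field_simps)
  qed
qed simp

text \<open>Injectivity on a finite type makes \<open>gold\<close> bijective, so the definite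
  description in \<open>gold_root_def\<close> has exactly one candidate.\<close>

lemma gold_root: "gold_root i y = x \<longleftrightarrow> gold x = y"
proof -
  have "surj gold"
    by (rule finite_UNIV_inj_surj) (simp_all add: inj_def)
  then obtain z where z: "y = gold z" by auto
  have "gold_root i y = z"
    unfolding gold_root_def gold_power[symmetric] z by (rule the_equality) auto
  then show ?thesis using z by auto
qed

lemma gold_gold_root [simp]: "gold (gold_root i y) = y"
  using gold_root by blast

lemma gold_g: "gold (g b) = inverse b"
  by (simp add: g_def gold_inverse)

lemma g_eq_0_iff [simp]: "g b = 0 \<longleftrightarrow> b = 0"
  by (metis gold_g gold_eq_0_iff inverse_nonzero_iff_nonzero)

lemma g_inverse_gold: "g (inverse (gold z)) = z"
  by (metis gold_eq_iff gold_g inverse_inverse_eq)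

lemma g_inj: "g b = g c \<longleftrightarrow> b = c"
  by (metis gold_g inverse_inverse_eq)

text \<open>The derivative of \<open>gold\<close> is affine in \<open>x\<close>, and invariance of
  the trace under \<open>sg\<close> collects its linear part into
  \<open>sg x * (y + sg (sg y))\<close>. The character sum vanishes unless
  \<open>sg (sg y) = y\<close>.\<close>

lemma autocorr_gold:
  "autocorr gold 1 y = (if y = 0 then 2 ^ m else if y = 1 then - (2 ^ m) else 0)"
proof -
  have "s (gold (x + y) + gold x) = s (gold y) * s (sg x * (y + sg (sg y)))" for x
  proof -
    have "s (gold (x + y) + gold x) = s (gold y) * (s (sg x * y) * s (x * sg y))"
      by (simp add: gold_add s_add[symmetric] ac_simps)
    also have "s (x * sg y) = s (sg x * sg (sg y))"
      by (metis s_sg sg_mult)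
    finally show ?thesis by (simp add: s_add distrib_left)
  qed
  then have "autocorr gold 1 y = s (gold y) * (\<Sum>x\<in>UNIV. s (sg x * (y + sg (sg y))))"
    by (simp add: autocorr_def sum_distrib_left)
  also have "\<dots> = s (gold y) * (\<Sum>x\<in>UNIV. s (x * (y + sg (sg y))))"
    using sum.reindex_bij_betw[OF bij_sg, of "\<lambda>x. s (x * (y + sg (sg y)))"] by simp
  finally show ?thesis
    using sg_sg_fixed[of y] by (auto simp: sum_s add_eq_0_iff_eq s_1)
qed

text \<open>Scaling by \<open>g b\<close> reduces to coefficient 1, where only the shifts 0 and 1
  contribute to \<open>walsh_square\<close>.\<close>

lemma walsh_gold:
  assumes "b \<noteq> 0"
  shows "(walsh m gold a b)\<^sup>2 = 2 ^ m * (1 - s (a * g b))"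
proof -
  define c where "c = a * g b"
  have "bij ((*) (g b))"
    by (rule bij_betw_byWitness[where f' = "(*) (inverse (g b))"])
      (use assms in \<open>auto simp flip: mult.assoc\<close>)
  then have "walsh m gold a b = (\<Sum>x\<in>UNIV. s (b * gold (g b * x) + a * (g b * x)))"
    unfolding walsh_def by (rule sum.reindex_bij_betw[symmetric])
  also have "\<dots> = walsh m gold c 1"
    using assms by (simp add: walsh_def c_def gold_mult gold_g flip: mult.assoc)
  finally have "(walsh m gold a b)\<^sup>2 = (\<Sum>y\<in>UNIV. autocorr gold 1 y * s (c * y))"
    by (simp add: walsh_square)
  also have "\<dots> = (\<Sum>y\<in>{0,1}. autocorr gold 1 y * s (c * y))"
    by (rule sum.mono_neutral_right) (auto simp: autocorr_gold)
  finally show ?thesis by (simp add: autocorr_gold c_def algebra_simps)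
qed

text \<open>With \<open>a = x + y\<close> and \<open>b = x + z\<close> the second equation becomes
  \<open>sg a * b = a * sg b\<close>, so \<open>a / b\<close> is fixed by \<open>sg\<close> and
  equals 1. The form with four points speaks of the graph alone and therefore transfers to the graph
  of \<open>F'\<close>.\<close>

lemma gold_apn:
  assumes "x + y + z + w = 0" "gold x + gold y + gold z + gold w = 0"
  shows "x = y \<or> x = z \<or> x = w"
proof (rule ccontr)
  assume *: "\<not> ?thesis"
  define a b where "a = x + y" and "b = x + z"
  have w: "w = x + y + z" using assms(1) by (simp add: add_eq_0_iff_eq)
  have y: "y = x + a" and z: "z = x + b" by (simp_all add: a_def b_def)
  have "sg a * b + a * sg b = 0"
    using assms(2) unfolding w y z by (simp add: gold_def sg_add algebra_simps)
  then have "sg a * b = a * sg b" by (simp add: add_eq_0_iff_eq)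
  moreover have "a \<noteq> 0" "b \<noteq> 0" using * by (auto simp: a_def b_def add_eq_0_iff_eq)
  ultimately have "sg (a * inverse b) = a * inverse b"
    by (simp add: sg_mult sg_inverse sg_def field_simps)
  then have "a * inverse b = 1"
    using sg_sg_fixed[of "a * inverse b"] \<open>a \<noteq> 0\<close> \<open>b \<noteq> 0\<close> by auto
  then have "a = b" using \<open>b \<noteq> 0\<close> by (simp add: field_simps)
  then have "w = x" unfolding w y z by (metis add.commute add_self_left)
  then show False using * by simp
qed

section \<open>The relative trace, the subfield and their duality\<close>

lemma T_add: "T (x + y) = T x + T y"
  by (rule rel_trace_add)

lemma T_0 [simp]: "T 0 = 0"
  using T_add[of 0 0] by simp

lemma T_sg: "T (sg x) = sg (T x)"
  by (simp add: sg_def rel_trace_frobenius)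

lemma T_sub [simp]: "T x \<in> sub"
  by (simp add: sub_def rel_trace_fixed n_dvd)

lemma sub_0 [simp]: "0 \<in> sub" and sub_1 [simp]: "1 \<in> sub"
  by (simp_all add: sub_def)

lemma sub_add: "x \<in> sub \<Longrightarrow> y \<in> sub \<Longrightarrow> x + y \<in> sub"
  by (simp add: sub_def frobenius_add)

lemma sub_mult: "x \<in> sub \<Longrightarrow> y \<in> sub \<Longrightarrow> x * y \<in> sub"
  by (simp add: sub_def power_mult_distrib)

lemma sub_inverse: "x \<in> sub \<Longrightarrow> inverse x \<in> sub"
  by (simp add: sub_def power_inverse)

lemma sub_power: "x \<in> sub \<Longrightarrow> x ^ k \<in> sub"
  by (induction k) (simp_all add: sub_mult)

lemma sub_add_cancel: "x \<in> sub \<Longrightarrow> x + y \<in> sub \<longleftrightarrow> y \<in> sub"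
  using sub_add[of x "x + y"] sub_add[of x y] by auto

text \<open>\<open>gold\<close> is injective and commutes with the power map whose fixed points form
  \<open>sub\<close>.\<close>

lemma sub_gold_iff [simp]: "gold x \<in> sub \<longleftrightarrow> x \<in> sub"
proof
  assume "gold x \<in> sub"
  then have "gold (x ^ (2 ^ n)) = gold x"
    unfolding sub_def gold_power by (metis (mono_tags) mem_Collect_eq mult.commute power_mult)
  then show "x \<in> sub" by (simp add: sub_def)
qed (simp add: gold_def sg_def sub_power sub_mult)

lemma sub_inverse_iff: "inverse x \<in> sub \<longleftrightarrow> x \<in> sub"
  using sub_inverse by force

lemma sub_g_iff [simp]: "g x \<in> sub \<longleftrightarrow> x \<in> sub"
  by (metis gold_g sub_gold_iff sub_inverse_iff)

lemma T_mult_sub: "c \<in> sub \<Longrightarrow> T (c * x) = c * T x"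
proof -
  assume "c \<in> sub"
  then have "c ^ (2 ^ (k * n)) = c" for k
    using frobenius_mult_iterate by (simp add: sub_def)
  then show ?thesis by (simp add: rel_trace_def power_mult_distrib sum_distrib_left)
qed

text \<open>\<open>T\<close> is \<open>sub\<close>-linear, and \<open>T 1\<close> is a sum of the
  odd number \<open>m div n\<close> of ones. Hence \<open>T\<close> is a projection onto
  \<open>sub\<close>.\<close>

lemma T_on_sub: "c \<in> sub \<Longrightarrow> T c = c"
proof -
  assume "c \<in> sub"
  moreover have "odd (m div n)" using odd_m n_dvd by (metis dvd_div_mult_self even_mult_iff)
  then have "T 1 = 1" by (simp add: rel_trace_def of_nat_odd)
  ultimately show ?thesis using T_mult_sub[of c 1] by simp
qed

text \<open>Transitivity of the trace: the exponents below \<open>m\<close> are grouped as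
  \<open>k * n + j\<close> with \<open>j < n\<close>.\<close>

lemma tr_T_tower: "tr x = (\<Sum>j<n. T x ^ (2 ^ j))"
proof -
  have m: "m = m div n * n" using n_dvd by simp
  have block: "(\<Sum>j = k..<k + n. x ^ (2 ^ j)) = (\<Sum>j<n. x ^ (2 ^ (k + j)))" for k
    using sum.shift_bounds_nat_ivl[of "\<lambda>j. x ^ (2 ^ j)" 0 k n]
    by (simp add: atLeast0LessThan add.commute)
  have "tr x = (\<Sum>k<m div n. sum (\<lambda>j. x ^ (2 ^ j)) {k * n..<k * n + n})"
    unfolding abs_trace_def by (subst (1) m) (rule sum.nat_group[symmetric])
  also have "\<dots> = (\<Sum>k<m div n. \<Sum>j<n. x ^ (2 ^ (k * n + j)))"
    by (simp add: block)
  also have "\<dots> = (\<Sum>j<n. \<Sum>k<m div n. x ^ (2 ^ (k * n + j)))"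
    by (rule sum.swap)
  finally show ?thesis
    by (simp add: rel_trace_def frobenius_sum frobenius_add_exp)
qed

lemma s_T_mult: "s (T x * y) = s (T x * T y)"
  by (intro s_cong) (simp add: tr_T_tower T_mult_sub T_on_sub)

text \<open>Both sides reduce to \<open>s (T x * T y)\<close>; thus \<open>T\<close> is self-adjoint
  for the trace form.\<close>

lemma s_T_swap: "s (T x * y) = s (x * T y)"
  by (metis s_T_mult mult.commute)

lemma s_T: "s (T x) = s x"
  using s_T_swap[of x 1] by (simp add: T_on_sub)

text \<open>\<open>ker\<close> contains \<open>z + z ^ (2 ^ n)\<close> for every \<open>z\<close>.
  Choosing \<open>z\<close> as the \<open>2 ^ n\<close>-th root of \<open>x\<close> turns
  orthogonality to these elements into orthogonality of \<open>y ^ (2 ^ n) + y\<close> to every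
  \<open>x\<close>.\<close>

lemma sub_dual:
  assumes "\<And>k. k \<in> ker \<Longrightarrow> s (k * y) = 1"
  shows "y \<in> sub"
proof -
  have "s (x * (y ^ (2 ^ n) + y)) = 1" for x
  proof -
    define z where "z = x ^ (2 ^ (m - n))"
    have z: "z ^ (2 ^ n) = x"
      using power_field[of x] n_dvd odd_m dvd_imp_le[of n m]
      by (simp add: z_def flip: frobenius_add_exp) (cases m; simp)
    have "z + x \<in> ker"
      using T_sub[of z] by (simp add: ker_def T_add rel_trace_frobenius sub_def flip: z)
    then have "s (z * y) * s (x * y) = 1"
      using assms[of "z + x"] by (simp add: distrib_right s_add)
    moreover have "s (z * y) = s (x * y ^ (2 ^ n))"
      using s_frobenius[of "z * y" n] by (simp add: power_mult_distrib z)
    ultimately show ?thesis by (simp add: s_add distrib_left)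
  qed
  then show ?thesis
    using tr_nondegenerate[of "y ^ (2 ^ n) + y"] by (simp add: sub_def add_eq_0_iff_eq)
qed

lemma s_ker_sub: "k \<in> ker \<Longrightarrow> y \<in> sub \<Longrightarrow> s (k * y) = 1"
  using s_T_swap[of k y] by (simp add: ker_def T_on_sub)

lemma sum_ker: "(\<Sum>k\<in>ker. s (k * w)) = (if w \<in> sub then int (card ker) else 0)"
proof (cases "w \<in> sub")
  case True
  then show ?thesis by (simp add: s_ker_sub)
next
  case False
  then obtain k where "k \<in> ker" "s (k * w) = - 1"
    using sub_dual s_cases by blast
  then show ?thesis
    using False sum_s_eq_0[of ker k w] by (simp add: ker_def T_add)
qed

lemma sum_sub:
  assumes "w \<in> sub"
  shows "(\<Sum>e\<in>sub. s (e * w)) = (if w = 0 then int (card sub) else 0)"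
proof (cases "w = 0")
  case False
  \<comment> \<open>The translation by \<open>T (inverse w)\<close> stays in \<open>sub\<close> and
    flips signs, because its product with \<open>w\<close> is the trace of 1.\<close>
  have "T (inverse w) * w = T (inverse w * w)"
    using T_mult_sub[OF assms, of "inverse w"] by (simp add: mult.commute)
  then have "s (T (inverse w) * w) = - 1"
    using False by (simp add: s_T s_1)
  then show ?thesis
    using False sum_s_eq_0[of sub "T (inverse w)" w] by (simp add: sub_add)
qed simp

section \<open>The function \<open>F'\<close>\<close>

abbreviation F' :: "'a \<Rightarrow> 'a" where "F' \<equiv> F_prime m n i"

definition W :: "'a \<Rightarrow> 'a" where "W x = gold (T x) + T (gold x) + T x"
definition R :: "'a \<Rightarrow> 'a" where "R x = gold_root i (W x)"
text \<open>\<open>F1\<close> and \<open>F2\<close> are the coordinates of the image of the graph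
  point \<open>(z, gold z)\<close> under the linear involution. \<open>G\<close> inverts
  \<open>F1\<close>, so that \<open>F'\<close> is \<open>F2\<close> after \<open>G\<close>.\<close>

definition F1 :: "'a \<Rightarrow> 'a" where "F1 z = z + T z + T (gold z)"
definition F2 :: "'a \<Rightarrow> 'a" where "F2 z = gold z + T z + T (gold z)"
definition G :: "'a \<Rightarrow> 'a" where "G x = x + T x + R x"

lemma gold_R: "sg (R x) * R x = W x"
  by (simp add: R_def flip: gold_def)

lemma F_prime_eq:
  "F' x = gold x + T (gold x) + sg x * T x + x * sg (T x) + R x * (sg x + sg (T x) + 1)
    + sg (R x) * (x + T x)"
  unfolding F_prime_def W_fun_def W_def R_def Let_def gold_power sg_def by (rule refl)

lemma sub_sg: "x \<in> sub \<Longrightarrow> sg x \<in> sub"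
  by (simp add: sg_def sub_power)

lemma R_sub [simp]: "R x \<in> sub"
proof -
  have "gold (R x) \<in> sub"
    by (simp add: gold_def gold_R) (simp add: W_def sub_add)
  then show ?thesis by simp
qed

lemma T_G: "T (G x) = R x"
  by (simp add: G_def T_add T_on_sub)

text \<open>\<open>G x\<close> differs from \<open>x\<close> by an element of \<open>sub\<close>, so
  \<open>T\<close> passes through the cross terms of \<open>gold\<close>. The equation
  \<open>gold (R x) = W x\<close> is what cancels everything except \<open>T x\<close>.\<close>

lemma T_gold_G: "T (gold (G x)) = T x"
proof -
  define u where "u = T x + R x"
  have u: "u \<in> sub" by (simp add: u_def sub_add)
  have "T (gold (x + u)) = T (gold x) + gold u + (sg (T x) * u + T x * sg u)"
    using u T_mult_sub[of "sg u" x]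
    by (simp add: gold_add T_add T_on_sub T_mult_sub T_sg mult.commute sub_sg)
  also have "\<dots> = T (gold x) + gold (T x) + W x"
    unfolding u_def gold_R[symmetric] by (simp add: gold_def sg_add algebra_simps)
  finally show ?thesis
    by (simp add: W_def G_def u_def add.assoc)
qed

lemma F1_G [simp]: "F1 (G x) = x"
  unfolding F1_def T_G T_gold_G by (simp add: G_def ac_simps)

lemma F2_G: "F2 (G x) = F' x"
proof -
  have "gold (G x) = gold x + sg x * T x + x * sg (T x) + R x * (sg x + sg (T x))
    + sg (R x) * (x + T x) + (T (gold x) + T x)"
    using gold_R[of x] unfolding W_def G_def
    by (simp add: gold_def sg_add algebra_simps)
  then show ?thesis
    unfolding F2_def T_G T_gold_G F_prime_eq by (simp add: algebra_simps)
qed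

lemma bij_G: "bij G"
proof -
  have "inj G" by (metis F1_G injI)
  then show ?thesis by (simp add: bij_def finite_UNIV_inj_surj)
qed

text \<open>After reindexing by \<open>G\<close>, self-adjointness of \<open>T\<close> moves the
  involution from the graph to the pair \<open>(a, b)\<close>.\<close>

lemma walsh_F_prime:
  "walsh m F' a b = walsh m gold (a + T (a + b)) (b + T (a + b))"
proof -
  have "walsh m F' a b = (\<Sum>x\<in>UNIV. s (b * F2 (G x) + a * F1 (G x)))"
    by (simp add: walsh_def F2_G)
  also have "\<dots> = (\<Sum>z\<in>UNIV. s (b * F2 z + a * F1 z))"
    by (rule sum.reindex_bij_betw[OF bij_G])
  also have "\<dots> = (\<Sum>z\<in>UNIV. s ((b + T (a + b)) * gold z + (a + T (a + b)) * z))"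
  proof (rule sum.cong[OF refl])
    fix z
    show "s (b * F2 z + a * F1 z) = s ((b + T (a + b)) * gold z + (a + T (a + b)) * z)"
    proof -
    have "s (b * F2 z + a * F1 z) = s (b * gold z + a * z) * s ((a + b) * T (gold z + z))"
      unfolding F1_def F2_def s_add[symmetric] T_add by (simp add: algebra_simps)
    also have "\<dots> = s (b * gold z + a * z) * s (T (a + b) * (gold z + z))"
      by (simp add: s_T_swap)
    finally show ?thesis
      unfolding s_add[symmetric] by (simp add: algebra_simps)
    qed
  qed
  finally show ?thesis by (simp add: walsh_def)
qed

lemma walsh_gold_0: "a \<noteq> 0 \<Longrightarrow> walsh m gold a 0 = 0"
  using sum_s[of a] by (simp add: walsh_def mult.commute)

text \<open>Here the transformed coefficient of \<open>gold\<close> is 0, and a nontrivial linear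
  character remains: were its coefficient 0 too, \<open>a = b\<close> and then
  \<open>b = T 0 = 0\<close> would follow.\<close>

lemma walsh_F_prime_degenerate:
  assumes "b \<noteq> 0" "b + T (a + b) = 0"
  shows "walsh m F' a b = 0"
proof -
  have "b = T (a + b)" using assms(2) by (simp add: add_eq_0_iff_eq)
  have "a + T (a + b) \<noteq> 0"
  proof
    assume "a + T (a + b) = 0"
    then have "a = b" using \<open>b = T (a + b)\<close> by (metis add_eq_0_iff_eq)
    then show False using \<open>b = T (a + b)\<close> assms(1) by simp
  qed
  then show ?thesis
    unfolding walsh_F_prime assms(2) by (rule walsh_gold_0)
qed

lemma walsh_F_prime_square:
  assumes "b \<noteq> 0"
  shows "(walsh m F' a b)\<^sup>2 = 0 \<or> (walsh m F' a b)\<^sup>2 = 2 ^ (m + 1)"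
proof (cases "b + T (a + b) = 0")
  case True
  then show ?thesis using walsh_F_prime_degenerate[OF assms] by simp
next
  case False
  define c where "c = (a + T (a + b)) * g (b + T (a + b))"
  show ?thesis
    unfolding walsh_F_prime walsh_gold[OF False] c_def[symmetric] using s_cases[of c] by auto
qed

lemma almost_bent_F_prime: "almost_bent m F'"
proof -
  define k where "k = (m + 1) div 2"
  have k: "2 * k = m + 1" using odd_m by (simp add: k_def)
  have vals: "\<bar>walsh m F' a b\<bar> = 0 \<or> \<bar>walsh m F' a b\<bar> = 2 ^ k" if "b \<noteq> 0" for a b
  proof -
    have "(walsh m F' a b)\<^sup>2 = (2 ^ k)\<^sup>2" if "walsh m F' a b \<noteq> 0"
      using walsh_F_prime_square[OF \<open>b \<noteq> 0\<close>, of a] that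
      by (metis k mult.commute power_mult power_zero_numeral zero_eq_power2)
    then show ?thesis
      by (cases "walsh m F' a b = 0") (auto simp: power2_eq_iff)
  qed
  \<comment> \<open>The Walsh values for \<open>b = 1\<close> cannot all vanish, so the value
    \<open>2 ^ k\<close> is attained.\<close>
  have "(\<Sum>a\<in>UNIV. walsh m F' a 1) \<noteq> 0"
    using s_cases[of "1 * F' 0"] unfolding sum_walsh by auto
  then obtain a where "walsh m F' a 1 \<noteq> 0"
    by (metis sum.neutral)
  then have "\<bar>walsh m F' a 1\<bar> = 2 ^ k"
    using vals[of 1 a] by simp
  define V where "V = {\<bar>walsh m F' a b\<bar> | a b. b \<noteq> 0}"
  have V: "V \<subseteq> {0, 2 ^ k}"
  proof
    fix v assume "v \<in> V"
    then obtain a b where "b \<noteq> 0" "v = \<bar>walsh m F' a b\<bar>" unfolding V_def by blast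
    then show "v \<in> {0, 2 ^ k}" using vals[of b a] by simp
  qed
  have "2 ^ k \<in> V"
    unfolding V_def using \<open>\<bar>walsh m F' a 1\<bar> = 2 ^ k\<close> zero_neq_one by (metis (mono_tags, lifting) mem_Collect_eq)
  then have "Max V = 2 ^ k"
    using V by (intro Max_eqI finite_subset[OF V]) auto
  \<comment> \<open>Halving \<open>2 ^ k\<close> yields the exponent \<open>(m - 1) div 2\<close>
    required by \<open>almost_bent_def\<close>.\<close>
  moreover have "k = Suc ((m - 1) div 2)" "(real m - 1) / 2 = real ((m - 1) div 2)"
    using odd_m by (auto simp: k_def elim!: oddE)
  ultimately show ?thesis
    by (simp add: almost_bent_def nonlinearity_def powr_realpow flip: V_def)
qed

text \<open>The four graph points sum to zero, and the involution carries this back to the graph of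
  \<open>gold\<close>: both coordinate sums \<open>S\<close> and \<open>S'\<close> equal
  \<open>T S + T S'\<close>, so they agree and hence vanish. Then \<open>gold_apn\<close>
  applies.\<close>

lemma F_prime_apn:
  assumes "y \<noteq> 0" "F' (x + y) + F' x = F' (z + y) + F' z"
  shows "x = z \<or> x = z + y"
proof -
  define S where "S = G (x + y) + G x + G (z + y) + G z"
  define S' where "S' = gold (G (x + y)) + gold (G x) + gold (G (z + y)) + gold (G z)"
  have "S + T S + T S' = F1 (G (x + y)) + F1 (G x) + F1 (G (z + y)) + F1 (G z)"
    unfolding S_def S'_def F1_def T_add by (simp only: ac_simps)
  also have "\<dots> = 0" unfolding F1_G by (simp add: ac_simps)
  finally have 1: "S + T S + T S' = 0" .
  have "S' + T S + T S' = F2 (G (x + y)) + F2 (G x) + F2 (G (z + y)) + F2 (G z)"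
    unfolding S_def S'_def F2_def T_add by (simp only: ac_simps)
  also have "\<dots> = 0" unfolding F2_G assms(2) by (metis add.assoc add_self)
  finally have 2: "S' + T S + T S' = 0" .
  have "S = T S + T S'" using 1 by (simp add: add_eq_0_iff_eq add.assoc)
  moreover have "S' = T S + T S'" using 2 by (simp add: add_eq_0_iff_eq add.assoc)
  ultimately have "S = 0" "S' = 0" by simp_all
  then have "G x = G (x + y) \<or> G x = G (z + y) \<or> G x = G z"
    unfolding S_def S'_def by (intro gold_apn) (simp_all add: ac_simps)
  then have "x = x + y \<or> x = z + y \<or> x = z"
    by (metis F1_G)
  then show ?thesis using assms(1) by auto
qed

text \<open>For \<open>b\<close> in \<open>sub\<close> the squared Walsh transform is invariant
  under translating \<open>a\<close> by \<open>ker\<close>, so its Fourier transform is supported on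
  the annihilator of \<open>ker\<close>, which is \<open>sub\<close>.\<close>

lemma autocorr_F_prime_on_sub:
  assumes "b \<noteq> 0" "b \<in> sub" "autocorr F' b y \<noteq> 0"
  shows "y \<in> sub"
proof (rule sub_dual, rule ccontr)
  fix k assume k: "k \<in> ker" "s (k * y) \<noteq> 1"
  have "(walsh m F' (a + k) b)\<^sup>2 = (walsh m F' a b)\<^sup>2" for a
  proof -
    have Tk: "T (a + k + b) = T (a + b)" using k by (simp add: ker_def T_add)
    have "s (k * g (b + T (a + b))) = 1"
      using k assms(2) by (intro s_ker_sub) (simp_all add: sub_add)
    then have "s ((a + k + T (a + b)) * g (b + T (a + b))) = s ((a + T (a + b)) * g (b + T (a + b)))"
      by (simp add: distrib_right s_add)
    then show ?thesis
      using walsh_F_prime_degenerate[OF assms(1), of a] walsh_F_prime_degenerate[OF assms(1), of "a + k"]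
      by (cases "b + T (a + b) = 0") (simp_all add: walsh_F_prime Tk walsh_gold)
  qed
  then have "2 ^ m * autocorr F' b y = (\<Sum>a\<in>UNIV. (walsh m F' (a + k) b)\<^sup>2 * s ((a + k) * y) * s (k * y))"
    by (simp add: autocorr_eq distrib_right s_add mult.assoc)
  also have "\<dots> = 2 ^ m * autocorr F' b y * s (k * y)"
    unfolding autocorr_eq sum_shift sum_distrib_right
    by (rule sum_shift[of "\<lambda>a. (walsh m F' a b)\<^sup>2 * s (a * y) * s (k * y)"])
  finally show False
    using k assms(3) s_cases[of "k * y"] by auto
qed

section \<open>Inequivalence to power functions\<close>

lemma zero_ker: "0 \<in> ker"
  by (simp add: ker_def)

text \<open>For \<open>b\<close> outside \<open>sub\<close> no \<open>a\<close> is degenerate, so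
  \<open>walsh_gold\<close> applies throughout; its constant term cancels because \<open>y\<close>
  is nonzero. Writing \<open>a = t + b + k\<close> with \<open>t = T (a + b)\<close> and
  \<open>k\<close> in \<open>ker\<close>, orthogonality over \<open>ker\<close> selects the
  admissible \<open>t\<close>.\<close>

lemma autocorr_F_prime_off_sub:
  assumes b: "b \<notin> sub" and "y \<noteq> 0"
  shows "autocorr F' b y = - (int (card ker) *
    (\<Sum>t | t \<in> sub \<and> g (b + t) + y \<in> sub. s (b * g (b + t) + (t + b) * y)))"
proof -
  define f where "f a = s ((a + T (a + b)) * g (b + T (a + b)) + a * y)" for a
  have walsh: "(walsh m F' a b)\<^sup>2 * s (a * y) = 2 ^ m * (s (a * y) - f a)" for a
  proof -
    have "b + T (a + b) \<noteq> 0" using b T_sub by (metis add_eq_0_iff_eq)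
    then show ?thesis
      by (simp add: walsh_F_prime walsh_gold f_def s_add left_diff_distrib mult.assoc)
  qed
  have "2 ^ m * autocorr F' b y = 2 ^ m * ((\<Sum>a\<in>UNIV. s (a * y)) - (\<Sum>a\<in>UNIV. f a))"
    by (simp only: autocorr_eq walsh sum_distrib_left[symmetric] sum_subtractf)
  also have "\<dots> = 2 ^ m * (- (\<Sum>a\<in>UNIV. f a))"
    using assms(2) by (simp add: sum_s)
  finally have "autocorr F' b y = - (\<Sum>a\<in>UNIV. f a)"
    by (simp only: mult_cancel_left) simp
  also have "(\<Sum>a\<in>UNIV. f a) = (\<Sum>(t, k)\<in>sub \<times> ker. f (t + b + k))"
  proof (rule sum.reindex_bij_witness[where j = "\<lambda>a. (T (a + b), a + b + T (a + b))"
        and i = "\<lambda>(t, k). t + b + k"])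
    fix p assume "p \<in> sub \<times> ker"
    then obtain t k where p: "p = (t, k)" "t \<in> sub" "T k = 0" by (auto simp: ker_def)
    then have "T (t + b + k + b) = t" by (simp add: T_add T_on_sub ac_simps)
    moreover have "t + b + k + b + t = k" by (simp add: ac_simps)
    ultimately show "(case p of (t, k) \<Rightarrow> t + b + k) \<in> UNIV"
      "(T ((case p of (t, k) \<Rightarrow> t + b + k) + b), (case p of (t, k) \<Rightarrow> t + b + k) + b + T ((case p of (t, k) \<Rightarrow> t + b + k) + b)) = p"
      using p by simp_all
  next
    fix a
    show "(T (a + b), a + b + T (a + b)) \<in> sub \<times> ker"
      by (simp add: ker_def T_add T_on_sub sub_add)
    show "(case (T (a + b), a + b + T (a + b)) of (t, k) \<Rightarrow> t + b + k) = a"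
      by (simp add: ac_simps)
    then show "(case (T (a + b), a + b + T (a + b)) of (t, k) \<Rightarrow> f (t + b + k)) = f a"
      by (simp only: prod.case)
  qed
  also have "\<dots> = (\<Sum>t\<in>sub. \<Sum>k\<in>ker. f (t + b + k))"
    by (rule sum.cartesian_product[symmetric])
  also have "\<dots> = (\<Sum>t\<in>sub. s (b * g (b + t) + (t + b) * y) *
      (if g (b + t) + y \<in> sub then int (card ker) else 0))"
  proof (rule sum.cong[OF refl])
    fix t assume t: "t \<in> sub"
    have "f (t + b + k) = s (b * g (b + t) + (t + b) * y) * s (k * (g (b + t) + y))" if "k \<in> ker" for k
    proof -
      have "T (t + b + k + b) = t" using that t by (simp add: ker_def T_add T_on_sub ac_simps)
      moreover have "t + b + k + t = b + k" by (simp add: ac_simps)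
      ultimately show ?thesis
        unfolding f_def s_add[symmetric] by (simp add: algebra_simps)
    qed
    then show "(\<Sum>k\<in>ker. f (t + b + k)) = s (b * g (b + t) + (t + b) * y) *
        (if g (b + t) + y \<in> sub then int (card ker) else 0)"
      by (simp only: sum_ker[symmetric] sum_distrib_left cong: sum.cong)
  qed
  also have "\<dots> = (\<Sum>t | t \<in> sub \<and> g (b + t) + y \<in> sub.
      s (b * g (b + t) + (t + b) * y) * int (card ker))"
    by (intro sum.mono_neutral_cong_right) auto
  finally show ?thesis by (simp add: sum_distrib_left mult.commute)
qed

text \<open>
  On the coset \<open>g b + sub\<close> the autocorrelation is the Fourier transform of a function with
  values \<open>\<plusminus> 1\<close>. If it is supported in one point, Parseval forces that function to be
  supported everywhere.
\<close>

lemma g_shift_in_sub: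
  assumes b: "b \<notin> sub"
    and single: "\<And>e e'. e \<in> sub \<Longrightarrow> e' \<in> sub \<Longrightarrow> autocorr F' b (g b + e) \<noteq> 0 \<Longrightarrow>
      autocorr F' b (g b + e') \<noteq> 0 \<Longrightarrow> e = e'"
    and "t \<in> sub"
  shows "g (b + t) + g b \<in> sub"
proof -
  define \<tau> where "\<tau> = {t \<in> sub. g (b + t) + g b \<in> sub}"
  define \<epsilon> where "\<epsilon> t = s (b * g (b + t) + (t + b) * g b)" for t
  define A where "A e = (\<Sum>t\<in>\<tau>. \<epsilon> t * s (e * t))" for e
  have "card ker > 0" using zero_ker by (simp add: card_gt_0_iff) blast
  have ac: "autocorr F' b (g b + e) \<noteq> 0 \<longleftrightarrow> A e \<noteq> 0" if e: "e \<in> sub" for e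
  proof -
    have "g b + e \<noteq> 0" using b e by (metis add_eq_0_iff_eq sub_g_iff)
    have "g (b + t) + (g b + e) \<in> sub \<longleftrightarrow> g (b + t) + g b \<in> sub" for t
      using sub_add_cancel[OF e, of "g (b + t) + g b"] by (simp add: ac_simps)
    then have "autocorr F' b (g b + e) = - (int (card ker) *
        (\<Sum>t\<in>\<tau>. s (b * g (b + t) + (t + b) * (g b + e))))"
      by (simp add: autocorr_F_prime_off_sub[OF b \<open>g b + e \<noteq> 0\<close>] \<tau>_def)
    also have "(\<Sum>t\<in>\<tau>. s (b * g (b + t) + (t + b) * (g b + e))) = s (b * e) * A e"
      unfolding A_def \<epsilon>_def sum_distrib_left s_add[symmetric]
      by (intro sum.cong refl) (simp add: algebra_simps flip: s_add)
    finally show ?thesis using \<open>card ker > 0\<close> s_cases[of "b * e"] by auto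
  qed
  have "(\<Sum>e\<in>sub. (A e)\<^sup>2) = (\<Sum>e\<in>sub. \<Sum>t\<in>\<tau>. \<Sum>u\<in>\<tau>. \<epsilon> t * \<epsilon> u * s (e * (t + u)))"
    unfolding A_def power2_eq_square sum_product
    by (simp add: distrib_left s_add mult_ac)
  also have "\<dots> = (\<Sum>t\<in>\<tau>. \<Sum>e\<in>sub. \<Sum>u\<in>\<tau>. \<epsilon> t * \<epsilon> u * s (e * (t + u)))"
    by (rule sum.swap)
  also have "\<dots> = (\<Sum>t\<in>\<tau>. \<Sum>u\<in>\<tau>. \<Sum>e\<in>sub. \<epsilon> t * \<epsilon> u * s (e * (t + u)))"
    by (intro sum.cong refl sum.swap)
  also have "\<dots> = (\<Sum>t\<in>\<tau>. \<Sum>u\<in>\<tau>. if u = t then int (card sub) else 0)"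
  proof (intro sum.cong refl)
    fix t u assume "t \<in> \<tau>" "u \<in> \<tau>"
    then have "t + u \<in> sub" by (simp add: \<tau>_def sub_add)
    then show "(\<Sum>e\<in>sub. \<epsilon> t * \<epsilon> u * s (e * (t + u))) = (if u = t then int (card sub) else 0)"
      by (auto simp: sum_sub add_eq_0_iff_eq \<epsilon>_def simp flip: sum_distrib_left)
  qed
  also have "\<dots> = int (card sub) * int (card \<tau>)" by simp
  finally have parseval: "(\<Sum>e\<in>sub. (A e)\<^sup>2) = int (card sub) * int (card \<tau>)" .
  have A_le: "(A e)\<^sup>2 \<le> (int (card \<tau>))\<^sup>2" for e
  proof -
    have "\<bar>\<epsilon> t * s (e * t)\<bar> = 1" for t
      using s_cases[of "e * t"] s_cases[of "b * g (b + t) + (t + b) * g b"] by (auto simp: \<epsilon>_def)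
    then have "\<bar>A e\<bar> \<le> (\<Sum>t\<in>\<tau>. 1)"
      unfolding A_def by (metis (no_types, lifting) sum.cong sum_abs)
    then show ?thesis by (simp add: abs_le_square_iff[symmetric])
  qed
  \<comment> \<open>At most one \<open>e\<close> contributes, so a single trivial bound controls the
    whole Parseval sum.\<close>
  have "(\<Sum>e\<in>sub. (A e)\<^sup>2) \<le> (int (card \<tau>))\<^sup>2"
  proof (cases "\<exists>e0\<in>sub. A e0 \<noteq> 0")
    case True
    then obtain e0 where e0: "e0 \<in> sub" "A e0 \<noteq> 0" by blast
    have "A e = 0" if "e \<in> sub - {e0}" for e
      using single[of e e0] ac e0 that by auto
    then have "(\<Sum>e\<in>sub. (A e)\<^sup>2) = (\<Sum>e\<in>{e0}. (A e)\<^sup>2)"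
      using e0(1) by (intro sum.mono_neutral_right) auto
    then show ?thesis using A_le by simp
  next
    case False
    then show ?thesis by simp
  qed
  moreover have "0 \<in> \<tau>" by (simp add: \<tau>_def)
  then have "card \<tau> > 0" by (auto simp: card_gt_0_iff)
  moreover have "int (card sub * card \<tau>) \<le> int (card \<tau> * card \<tau>)"
    using calculation(1) unfolding parseval by (simp add: power2_eq_square)
  ultimately have "card sub \<le> card \<tau>"
    unfolding of_nat_le_iff by simp
  then have "\<tau> = sub"
    by (intro card_seteq) (auto simp: \<tau>_def)
  then show ?thesis using assms(3) by (auto simp: \<tau>_def)
qed

text \<open>With \<open>b = inverse (gold z)\<close>, the map sending \<open>t\<close> to
  \<open>g (b + t) + g b\<close> is an injective self-map of \<open>sub\<close>, hence onto. At a
  preimage \<open>t\<close> of 1 it gives \<open>g (b + t) = z + 1\<close>, so the sum in question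
  is \<open>t\<close>.\<close>

lemma gold_difference_in_sub:
  assumes shift: "\<And>b t. b \<notin> sub \<Longrightarrow> t \<in> sub \<Longrightarrow> g (b + t) + g b \<in> sub" and "z \<notin> sub"
  shows "inverse (gold z) + inverse (gold (z + 1)) \<in> sub"
proof -
  define b where "b = inverse (gold z)"
  have gb: "g b = z" by (simp add: b_def g_inverse_gold)
  then have b: "b \<notin> sub" using assms(2) sub_g_iff by metis
  have "(\<lambda>t. g (b + t) + g b) ` sub = sub"
  proof (rule endo_inj_surj)
    show "inj_on (\<lambda>t. g (b + t) + g b) sub"
      by (rule inj_onI) (metis add_left_cancel add_right_cancel g_inj)
  qed (use shift[OF b] in auto)
  then obtain t where t: "t \<in> sub" "1 = g (b + t) + g b"
    by (metis (no_types, lifting) imageE sub_1)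
  then have "g (b + t) = z + 1"
    unfolding gb by (metis add.commute add_self_left)
  then have "b + t = inverse (gold (z + 1))"
    by (metis gold_g inverse_inverse_eq)
  then have "b + inverse (gold (z + 1)) = t" by (metis add_self_left)
  then show ?thesis using t(1) by (simp add: b_def)
qed

section \<open>Counting roots of polynomials\<close>

lemma card_sub_le: "card sub \<le> 2 ^ n"
proof -
  define p :: "'a poly" where "p = monom 1 (2 ^ n) - monom 1 1"
  have "1 < (2::nat) ^ n" using n_pos by (intro one_less_power) simp_all
  then have "coeff p (2 ^ n) = 1" by (simp add: p_def)
  then have "p \<noteq> 0" by auto
  have "sub = {x. poly p x = 0}"
    by (simp add: sub_def p_def poly_monom add_eq_0_iff_eq)
  then have "card sub \<le> degree p" using card_poly_roots_bound[OF \<open>p \<noteq> 0\<close>] by simp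
  also have "degree p \<le> 2 ^ n"
    unfolding p_def by (intro degree_diff_le) (use \<open>1 < 2 ^ n\<close> in \<open>simp_all add: degree_monom_eq\<close>)
  finally show ?thesis .
qed

text \<open>Clearing denominators gives a polynomial of degree at most \<open>2 * d\<close>; its
  value 1 at 0 shows that it is not zero.\<close>

lemma card_gold_difference_le:
  fixes d :: nat
  assumes "d > 0" "t \<noteq> (0::'a)"
  shows "card {z. z \<noteq> 0 \<and> z + 1 \<noteq> 0 \<and> inverse (z ^ d) + inverse ((z + 1) ^ d) = t} \<le> 2 * d"
proof -
  define p where "p = smult t ([:0, 1:] ^ d * [:1, 1:] ^ d) - ([:0, 1:] ^ d + [:1, 1:] ^ d)"
  have poly: "poly p z = t * (z ^ d * (z + 1) ^ d) + (z ^ d + (z + 1) ^ d)" for z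
    by (simp add: p_def add.commute)
  have "poly p 0 = 1" unfolding poly using assms(1) by (simp add: power_0_left)
  then have "p \<noteq> 0" by auto
  have "{z. z \<noteq> 0 \<and> z + 1 \<noteq> 0 \<and> inverse (z ^ d) + inverse ((z + 1) ^ d) = t} \<subseteq> {z. poly p z = 0}"
  proof safe
    fix z :: 'a assume "z \<noteq> 0" "z + 1 \<noteq> 0"
    then have nz: "z ^ d \<noteq> 0" "(z + 1) ^ d \<noteq> 0" by simp_all
    have "inverse u * (u * v) = v" if "u \<noteq> 0" for u v :: 'a
      using that by (simp flip: mult.assoc)
    from this[OF nz(1), of "(z + 1) ^ d"] this[OF nz(2), of "z ^ d"]
    show "poly p z = 0" if "t = inverse (z ^ d) + inverse ((z + 1) ^ d)"
      unfolding poly that distrib_right[of "inverse (z ^ d)"]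
      by (simp only: mult.commute[of "z ^ d" "(z + 1) ^ d"]) (simp add: ac_simps)
  qed
  then have "card {z. z \<noteq> 0 \<and> z + 1 \<noteq> 0 \<and> inverse (z ^ d) + inverse ((z + 1) ^ d) = t}
      \<le> card {z. poly p z = 0}"
    by (intro card_mono) simp_all
  also have "\<dots> \<le> degree p" by (rule card_poly_roots_bound) fact
  also have "degree p \<le> 2 * d"
  proof -
    have "degree ([:0, 1:] ^ d * [:1, 1:] ^ d :: 'a poly) \<le> d + d"
      using degree_mult_le[of "[:0, 1:] ^ d :: 'a poly" "[:1, 1:] ^ d"] by (simp only: degree_linear_power)
    moreover have "degree ([:0, 1:] ^ d + [:1, 1:] ^ d :: 'a poly) \<le> d"
      by (intro degree_add_le) (simp_all only: degree_linear_power)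
    ultimately show ?thesis
      unfolding p_def by (intro degree_diff_le) (auto intro: order.trans[OF degree_smult_le])
  qed
  finally show ?thesis .
qed

text \<open>
  Up to a power of the Frobenius automorphism, \<open>i\<close> may be replaced by \<open>\<plusminus> i\<close> modulo \<open>m\<close>;
  this keeps the degree of the polynomial above small.
\<close>

lemma small_gold_exponent:
  obtains j l where "2 * j < m" "\<And>x. x ^ (2 ^ j + 1) = gold x ^ (2 ^ l)"
proof -
  define r where "r = i mod m"
  have "r < m" using odd_m by (cases m) (auto simp: r_def)
  have sg_r: "sg x = x ^ (2 ^ r)" for x
  proof -
    have "sg x = x ^ (2 ^ (i div m * m + r))" by (simp add: sg_def r_def)
    then show ?thesis
      unfolding frobenius_add_exp using frobenius_mult_iterate[OF power_field, where j = "i div m"]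
      by simp
  qed
  show thesis
  proof (cases "2 * r < m")
    case True
    then show ?thesis by (intro that[of r 0]) (simp_all add: gold_def sg_r)
  next
    case False
    \<comment> \<open>The Frobenius iterate with index \<open>m - r\<close> sends the factors
      \<open>x ^ (2 ^ r)\<close> and \<open>x\<close> of \<open>gold x\<close> to \<open>x\<close>
      and \<open>x ^ (2 ^ (m - r))\<close>.\<close>
    have "x ^ (2 ^ (m - r) + 1) = gold x ^ (2 ^ (m - r))" for x
    proof -
      have "(x ^ (2 ^ r)) ^ (2 ^ (m - r)) = x"
        using \<open>r < m\<close> power_field[of x] by (simp flip: frobenius_add_exp)
      then show ?thesis by (simp add: gold_def sg_r power_mult_distrib)
    qed
    then show ?thesis using False odd_m \<open>r < m\<close> by (intro that[of "m - r" "m - r"]) presburger+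
  qed
qed

text \<open>Otherwise the complement of \<open>sub\<close> is covered by at most
  \<open>2 ^ n - 1\<close> fibres \<open>Z t\<close> with at most \<open>2 * d\<close> elements
  each, too few when \<open>m\<close> is not 3.\<close>

lemma gold_difference_not_in_sub:
  assumes "m \<noteq> 3"
  shows "\<exists>z. z \<notin> sub \<and> inverse (gold z) + inverse (gold (z + 1)) \<notin> sub"
proof (rule ccontr)
  assume contra: "\<not> ?thesis"
  obtain j l where j: "2 * j < m" and gold_l: "\<And>x. x ^ (2 ^ j + 1) = gold x ^ (2 ^ l)"
    using small_gold_exponent by blast
  define d where "d = 2 ^ j + (1::nat)"
  define Z where "Z t = {z::'a. z \<noteq> 0 \<and> z + 1 \<noteq> 0 \<and> inverse (z ^ d) + inverse ((z + 1) ^ d) = t}" for t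
  have "UNIV - sub \<subseteq> (\<Union>t\<in>sub - {0}. Z t)"
  proof
    fix z assume "z \<in> UNIV - sub"
    then have z: "z \<notin> sub" by simp
    define t where "t = inverse (gold z) + inverse (gold (z + 1))"
    have "t \<in> sub" using contra z by (auto simp: t_def)
    have "t \<noteq> 0"
    proof
      assume "t = 0"
      then have "inverse (gold z) = inverse (gold (z + 1))" by (simp add: t_def add_eq_0_iff_eq)
      then have "z = z + 1" by simp
      then show False by simp
    qed
    \<comment> \<open>A Frobenius power passes from \<open>gold\<close> to the exponent
      \<open>d\<close> and keeps the value in \<open>sub\<close>.\<close>
    have "inverse (z ^ d) + inverse ((z + 1) ^ d) = t ^ (2 ^ l)"
      unfolding d_def gold_l t_def frobenius_add by (simp add: power_inverse)
    moreover have "z \<noteq> 0" "z + 1 \<noteq> 0"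
      using z by (auto simp: add_eq_0_iff_eq)
    ultimately have "z \<in> Z (t ^ (2 ^ l))" by (simp add: Z_def)
    moreover have "t ^ (2 ^ l) \<in> sub - {0}"
      using \<open>t \<in> sub\<close> \<open>t \<noteq> 0\<close> by (simp add: sub_power)
    ultimately show "z \<in> (\<Union>t\<in>sub - {0}. Z t)" by blast
  qed
  then have "card (UNIV - sub) \<le> card (\<Union>t\<in>sub - {0}. Z t)"
    by (intro card_mono) simp_all
  also have "\<dots> \<le> (\<Sum>t\<in>sub - {0}. card (Z t))" by (rule card_UN_le) simp
  also have "\<dots> \<le> (\<Sum>t\<in>sub - {0}. 2 * d)"
    unfolding Z_def by (intro sum_mono card_gold_difference_le) (auto simp: d_def)
  also have "\<dots> = (card sub - 1) * (2 * d)" by simp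
  also have "\<dots> \<le> (2 ^ n - 1) * (2 * d)"
    using card_sub_le by (intro mult_right_mono) simp_all
  finally have upper: "card (UNIV - sub) \<le> (2 ^ n - 1) * (2 * d)" .
  have "card (UNIV - sub) = 2 ^ m - card sub"
    by (simp add: card_Diff_subset card_field)
  then have lower: "2 ^ m - 2 ^ n \<le> card (UNIV - sub)"
    using card_sub_le by simp
  obtain l where l: "m = n * l" using n_dvd by blast
  have "odd l" "odd n" using odd_m l by auto
  have "l \<noteq> 1" using n_neq l by auto
  with \<open>odd l\<close> have "l \<ge> 3" by presburger
  then have "3 * n \<le> m" using l by (simp add: mult.commute)
  \<comment> \<open>This is where \<open>m = 3\<close> is excluded: there \<open>n = 1\<close>, and
    the second bound would read \<open>3 <= 2\<close>.\<close>
  have exponents: "n + (j + 1) \<le> m - 1" "n + 2 \<le> m - 1"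
  proof -
    have "m \<noteq> 1" "even m \<longleftrightarrow> False" using \<open>3 * n \<le> m\<close> n_pos odd_m by auto
    then have "m = 5 \<or> m = 7 \<or> m \<ge> 9"
      using assms by presburger
    then consider "m = 5" | "m = 7" | "m \<ge> 9" by blast
    then show "n + (j + 1) \<le> m - 1" "n + 2 \<le> m - 1"
      using \<open>3 * n \<le> m\<close> j by (cases; linarith)+
  qed
  define N where "N = (2::nat) ^ n"
  have "N \<ge> 1" by (simp add: N_def)
  have "N * (2 * d) = 2 ^ (n + (j + 1)) + 2 * N"
    by (simp add: N_def d_def power_add algebra_simps)
  also have "\<dots> \<le> 2 ^ (m - 1) + 2 * N"
    using exponents(1) by (intro add_right_mono power_increasing) simp_all
  finally have 1: "N * (2 * d) \<le> 2 ^ (m - 1) + 2 * N" .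
  have "4 * N = 2 ^ (n + 2)" by (simp add: N_def)
  also have "\<dots> \<le> 2 ^ (m - 1)"
    using exponents(2) by (intro power_increasing) simp_all
  finally have 2: "4 * N \<le> 2 ^ (m - 1)" .
  have 3: "(2::nat) ^ m = 2 * 2 ^ (m - 1)" using odd_m by (cases m) auto
  have 4: "2 ^ m \<le> N + (N - 1) * (2 * d)" using upper lower by (simp add: N_def)
  have 5: "(N - 1) * (2 * d) + 2 * d = N * (2 * d)"
    using \<open>N \<ge> 1\<close> by (cases N) auto
  \<comment> \<open>The bounds combine to
    \<open>2 ^ m <= 2 ^ (m - 1) + 3 * N < 2 ^ (m - 1) + 4 * N <= 2 ^ m\<close>.\<close>
  show False using 1 2 3 4 5 \<open>N \<ge> 1\<close> by linarith
qed

text \<open>The support lemma for \<open>H = sub\<close> supplies the one-point hypothesis of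
  \<open>g_shift_in_sub\<close>; the resulting membership in \<open>sub\<close> contradicts the
  count.\<close>

lemma F_prime_not_EA_equivalent_power:
  assumes "m \<noteq> 3"
  shows "\<not> EA_equivalent F' (\<lambda>x. x powi k)"
proof
  assume EA: "EA_equivalent F' (\<lambda>x. x powi k)"
  have "apn F'" using F_prime_apn by (auto simp: apn_def)
  have "g (b + t) + g b \<in> sub" if b: "b \<notin> sub" and "t \<in> sub" for b t
  proof (rule g_shift_in_sub[OF b _ \<open>t \<in> sub\<close>])
    fix e e' assume e: "e \<in> sub" "e' \<in> sub"
      and ac: "autocorr F' b (g b + e) \<noteq> 0" "autocorr F' b (g b + e') \<noteq> 0"
    have nonzero: "g b + u \<noteq> 0" if "u \<in> sub" for u
      using that b by (metis add_eq_0_iff_eq sub_g_iff)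
    have sum: "(g b + e) + (g b + e') \<in> sub"
      using sub_add[OF e] by (simp add: ac_simps)
    have "g b + e = g b + e'"
      by (rule EA_equivalent_power_autocorr_support[OF EA \<open>apn F'\<close> sub_0 _ _ b
          nonzero[OF e(1)] ac(1) nonzero[OF e(2)] ac(2) sum])
        (simp_all add: sub_add autocorr_F_prime_on_sub)
    then show "e = e'" by simp
  qed
  then show False
    using gold_difference_in_sub gold_difference_not_in_sub[OF assms] by blast
qed

end

theorem theorem4:
  fixes m n i :: nat
  assumes "CARD('a::{field,finite}) = 2 ^ m"
    and "odd m" and "n dvd m" and "n \<noteq> m"
    and "i > 0" and "gcd m i = 1"
  shows "almost_bent m (F_prime m n i :: 'a \<Rightarrow> 'a) \<and>
    (m \<noteq> 3 \<longrightarrow>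
      (\<forall>P. power_function P \<longrightarrow> \<not> EA_equivalent (F_prime m n i :: 'a \<Rightarrow> 'a) P))"
proof -
  interpret gold_setup m "TYPE('a)" n i
    by unfold_locales (use assms in \<open>simp_all add: coprime_iff_gcd_eq_1\<close>)
  have "\<not> EA_equivalent F' P" if "m \<noteq> 3" and "power_function P" for P
  proof -
    obtain k where "P = (\<lambda>x. x powi k)"
      using \<open>power_function P\<close> unfolding power_function_def by blast
    then show ?thesis using F_prime_not_EA_equivalent_power[OF \<open>m \<noteq> 3\<close>] by simp
  qed
  then show ?thesis using almost_bent_F_prime by blast
qed

end
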